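(* Let $R$ be a unital commutative ring and $G$ be a finite group. If $R$ has no $|G|$-torsion, then the only derivation of the Burnside algebra $RB(G)$ is zero, i.e. $HH^1\big(RB(G),RB(G)\big)=0$.
   Context: The Burnside ring $B(G)$ of a finite group $G$ is the Grothendieck ring of finite $G$-sets (addition from disjoint union, product from cartesian product with diagonal action), and $RB(G)=R\otimes_{\mathbb{Z}}B(G)$, a commutative $R$-algebra. A derivation of $RB(G)$ is an $R$-linear map $d:RB(G)\to RB(G)$ with $d(ab)=a\,d(b)+d(a)\,b$. $HH^1\big(RB(G),RB(G)\big)$ is the first Hochschild cohomology of the $R$-algebra $RB(G)$ with coefficients in itself, i.e. $R$-linear derivations modulo inner derivations (inner derivations are zero since $RB(G)$ is commutative). "$R$ has no $|G|$-torsion" means that $|G|r=0$ with $r\in R$ implies $r=0$. *)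

theory Defs
  imports "HOL-Algebra.Algebra"
begin

section \<open>Finite \<open>G\<close>-sets\<close>

text \<open>A \<open>G\<close>-set is a pair of an underlying set and an action, in the sense of
  the library's \<^locale>\<open>group_action\<close>.\<close>

type_synonym ('g, 'x) gset = "'x set \<times> ('g \<Rightarrow> 'x \<Rightarrow> 'x)"

definition finite_gset :: "('g, 'm) monoid_scheme \<Rightarrow> ('g, 'x) gset \<Rightarrow> bool" where
  "finite_gset G U \<longleftrightarrow> finite (fst U) \<and> group_action G (fst U) (snd U)"

definition gset_iso :: "('g, 'm) monoid_scheme \<Rightarrow> ('g, 'x) gset \<Rightarrow> ('g, 'y) gset \<Rightarrow> bool" where
  "gset_iso G U V \<longleftrightarrow>
     (\<exists>f. bij_betw f (fst U) (fst V) \<and>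
          (\<forall>g\<in>carrier G. \<forall>x\<in>fst U. f (snd U g x) = snd V g (f x)))"

definition gset_sum :: "('g, 'x) gset \<Rightarrow> ('g, 'y) gset \<Rightarrow> ('g, 'x + 'y) gset" where
  "gset_sum U V = (fst U <+> fst V, \<lambda>g. \<lambda>z\<in>fst U <+> fst V. map_sum (snd U g) (snd V g) z)"

definition gset_prod :: "('g, 'x) gset \<Rightarrow> ('g, 'y) gset \<Rightarrow> ('g, 'x \<times> 'y) gset" where
  "gset_prod U V = (fst U \<times> fst V, \<lambda>g. \<lambda>z\<in>fst U \<times> fst V. map_prod (snd U g) (snd V g) z)"

definition gset_empty :: "('g, unit) gset" where
  "gset_empty = ({}, \<lambda>g. \<lambda>x\<in>{}. x)"

definition gset_point :: "('g, unit) gset" where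
  "gset_point = ({()}, \<lambda>g. \<lambda>x\<in>{()}. x)"

text \<open>Every finite \<open>G\<close>-set is isomorphic to one whose underlying set consists of natural
  numbers. The isomorphism class of a finite \<open>G\<close>-set \<open>U\<close> of any type is therefore
  represented by the (nonempty) set of all \<open>G\<close>-sets on natural numbers isomorphic to \<open>U\<close>.\<close>

type_synonym 'g gset_iso_class = "('g, nat) gset set"

definition gset_class :: "('g, 'm) monoid_scheme \<Rightarrow> ('g, 'x) gset \<Rightarrow> 'g gset_iso_class" where
  "gset_class G U = {Z. finite_gset G Z \<and> gset_iso G Z U}"

definition gset_semiring :: "('g, 'm) monoid_scheme \<Rightarrow> 'g gset_iso_class ring" where
  "gset_semiring G =
     \<lparr>carrier = {gset_class G U | U :: ('g, nat) gset. finite_gset G U},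
      monoid.mult = \<lambda>A B. \<Union>U\<in>A. \<Union>V\<in>B. gset_class G (gset_prod U V),
      one = gset_class G gset_point,
      ring.zero = gset_class G gset_empty,
      ring.add = \<lambda>A B. \<Union>U\<in>A. \<Union>V\<in>B. gset_class G (gset_sum U V)\<rparr>"


section \<open>The Grothendieck ring of a commutative semiring\<close>

text \<open>The pair \<open>(a, b)\<close> stands for the formal difference \<open>a - b\<close>. The
  semiring is not assumed to be additively cancellative, hence the summand \<open>k\<close>.\<close>

definition grothendieck_rel :: "('a, 'm) ring_scheme \<Rightarrow> (('a \<times> 'a) \<times> ('a \<times> 'a)) set" where
  "grothendieck_rel S =
     {((a, b), (c, d)) | a b c d.
        a \<in> carrier S \<and> b \<in> carrier S \<and> c \<in> carrier S \<and> d \<in> carrier S \<and>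
        (\<exists>k\<in>carrier S. a \<oplus>\<^bsub>S\<^esub> d \<oplus>\<^bsub>S\<^esub> k = c \<oplus>\<^bsub>S\<^esub> b \<oplus>\<^bsub>S\<^esub> k)}"

definition grothendieck_ring :: "('a, 'm) ring_scheme \<Rightarrow> ('a \<times> 'a) set ring" where
  "grothendieck_ring S =
     \<lparr>carrier = (carrier S \<times> carrier S) // grothendieck_rel S,
      monoid.mult = \<lambda>P Q. \<Union>(a, b)\<in>P. \<Union>(c, d)\<in>Q.
        grothendieck_rel S ``
          {(a \<otimes>\<^bsub>S\<^esub> c \<oplus>\<^bsub>S\<^esub> b \<otimes>\<^bsub>S\<^esub> d, a \<otimes>\<^bsub>S\<^esub> d \<oplus>\<^bsub>S\<^esub> b \<otimes>\<^bsub>S\<^esub> c)},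
      one = grothendieck_rel S `` {(\<one>\<^bsub>S\<^esub>, \<zero>\<^bsub>S\<^esub>)},
      ring.zero = grothendieck_rel S `` {(\<zero>\<^bsub>S\<^esub>, \<zero>\<^bsub>S\<^esub>)},
      ring.add = \<lambda>P Q. \<Union>(a, b)\<in>P. \<Union>(c, d)\<in>Q.
        grothendieck_rel S `` {(a \<oplus>\<^bsub>S\<^esub> c, b \<oplus>\<^bsub>S\<^esub> d)}\<rparr>"

definition burnside_ring :: "('g, 'm) monoid_scheme \<Rightarrow> ('g gset_iso_class \<times> 'g gset_iso_class) set ring" where
  "burnside_ring G = grothendieck_ring (gset_semiring G)"


section \<open>Tensor product of commutative rings over the integers\<close>

text \<open>The free abelian group on \<open>R \<times> S\<close>, with the biadditive multiplication that extends
  \<open>(r, a) (s, b) = (r s, a b)\<close> on generators.\<close>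

definition free_pair_ring ::
  "('r, 'm) ring_scheme \<Rightarrow> ('s, 'n) ring_scheme \<Rightarrow> ('r \<times> 's \<Rightarrow>\<^sub>0 int) ring" where
  "free_pair_ring R S =
     \<lparr>carrier = carrier (free_Abelian_group (carrier R \<times> carrier S)),
      monoid.mult = \<lambda>u v. frag_extend (\<lambda>(r, a). frag_extend (\<lambda>(s, b).
        frag_of (r \<otimes>\<^bsub>R\<^esub> s, a \<otimes>\<^bsub>S\<^esub> b)) v) u,
      one = frag_of (\<one>\<^bsub>R\<^esub>, \<one>\<^bsub>S\<^esub>),
      ring.zero = 0,
      ring.add = (+)\<rparr>"

text \<open>Additivity in both arguments already forces balancedness over the integers.\<close>

definition tensor_relations ::
  "('r, 'm) ring_scheme \<Rightarrow> ('s, 'n) ring_scheme \<Rightarrow> ('r \<times> 's \<Rightarrow>\<^sub>0 int) set" where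
  "tensor_relations R S =
     {frag_of (r \<oplus>\<^bsub>R\<^esub> r', a) - frag_of (r, a) - frag_of (r', a) | r r' a.
        r \<in> carrier R \<and> r' \<in> carrier R \<and> a \<in> carrier S} \<union>
     {frag_of (r, a \<oplus>\<^bsub>S\<^esub> a') - frag_of (r, a) - frag_of (r, a') | r a a'.
        r \<in> carrier R \<and> a \<in> carrier S \<and> a' \<in> carrier S}"

text \<open>The additive subgroup generated by the relations is an ideal of
  \<^const>\<open>free_pair_ring\<close>, so that the quotient carries the induced multiplication.\<close>

definition tensor_kernel ::
  "('r, 'm) ring_scheme \<Rightarrow> ('s, 'n) ring_scheme \<Rightarrow> ('r \<times> 's \<Rightarrow>\<^sub>0 int) set" where
  "tensor_kernel R S = generate (add_monoid (free_pair_ring R S)) (tensor_relations R S)"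

definition tensor_ring ::
  "('r, 'm) ring_scheme \<Rightarrow> ('s, 'n) ring_scheme \<Rightarrow> ('r \<times> 's \<Rightarrow>\<^sub>0 int) set ring" where
  "tensor_ring R S = free_pair_ring R S Quot tensor_kernel R S"

definition pure_tensor ::
  "('r, 'm) ring_scheme \<Rightarrow> ('s, 'n) ring_scheme \<Rightarrow> 'r \<Rightarrow> 's \<Rightarrow> ('r \<times> 's \<Rightarrow>\<^sub>0 int) set" where
  "pure_tensor R S r a = tensor_kernel R S +>\<^bsub>free_pair_ring R S\<^esub> frag_of (r, a)"

text \<open>Scalars act through the ring homomorphism sending \<open>r\<close> to the pure tensor of \<open>r\<close> and \<open>1\<close>.\<close>

definition tensor_algebra ::
  "('r, 'm) ring_scheme \<Rightarrow> ('s, 'n) ring_scheme \<Rightarrow> ('r, ('r \<times> 's \<Rightarrow>\<^sub>0 int) set) module" where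
  "tensor_algebra R S =
     \<lparr>carrier = carrier (tensor_ring R S),
      monoid.mult = monoid.mult (tensor_ring R S),
      one = one (tensor_ring R S),
      ring.zero = ring.zero (tensor_ring R S),
      ring.add = ring.add (tensor_ring R S),
      smult = \<lambda>r x. pure_tensor R S r \<one>\<^bsub>S\<^esub> \<otimes>\<^bsub>tensor_ring R S\<^esub> x\<rparr>"

definition burnside_algebra ::
  "('r, 'm) ring_scheme \<Rightarrow> ('g, 'n) monoid_scheme \<Rightarrow>
   ('r, ('r \<times> ('g gset_iso_class \<times> 'g gset_iso_class) set \<Rightarrow>\<^sub>0 int) set) module" where
  "burnside_algebra R G = tensor_algebra R (burnside_ring G)"


section \<open>Derivations and first Hochschild cohomology\<close>

text \<open>Derivations are taken to be extensional, so that equality of derivations is equality on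
  the carrier. The definitions also make sense for noncommutative algebras.\<close>

definition derivations :: "('r, 'm) ring_scheme \<Rightarrow> ('r, 'a, 'n) module_scheme \<Rightarrow> ('a \<Rightarrow> 'a) set" where
  "derivations R A =
     {d \<in> carrier A \<rightarrow>\<^sub>E carrier A.
        (\<forall>a\<in>carrier A. \<forall>b\<in>carrier A. d (a \<oplus>\<^bsub>A\<^esub> b) = d a \<oplus>\<^bsub>A\<^esub> d b) \<and>
        (\<forall>r\<in>carrier R. \<forall>a\<in>carrier A. d (r \<odot>\<^bsub>A\<^esub> a) = r \<odot>\<^bsub>A\<^esub> d a) \<and>
        (\<forall>a\<in>carrier A. \<forall>b\<in>carrier A. d (a \<otimes>\<^bsub>A\<^esub> b) = a \<otimes>\<^bsub>A\<^esub> d b \<oplus>\<^bsub>A\<^esub> d a \<otimes>\<^bsub>A\<^esub> b)}"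

definition inner_derivations :: "('r, 'a, 'n) module_scheme \<Rightarrow> ('a \<Rightarrow> 'a) set" where
  "inner_derivations A =
     {\<lambda>x\<in>carrier A. (c \<otimes>\<^bsub>A\<^esub> x) \<ominus>\<^bsub>A\<^esub> (x \<otimes>\<^bsub>A\<^esub> c) | c. c \<in> carrier A}"

definition zero_derivation :: "('r, 'a, 'n) module_scheme \<Rightarrow> 'a \<Rightarrow> 'a" where
  "zero_derivation A = (\<lambda>x\<in>carrier A. \<zero>\<^bsub>A\<^esub>)"

definition derivation_group ::
  "('r, 'm) ring_scheme \<Rightarrow> ('r, 'a, 'n) module_scheme \<Rightarrow> ('a \<Rightarrow> 'a) monoid" where
  "derivation_group R A =
     \<lparr>carrier = derivations R A,
      monoid.mult = \<lambda>d e. \<lambda>x\<in>carrier A. d x \<oplus>\<^bsub>A\<^esub> e x,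
      one = zero_derivation A\<rparr>"

definition HH1 ::
  "('r, 'm) ring_scheme \<Rightarrow> ('r, 'a, 'n) module_scheme \<Rightarrow> ('a \<Rightarrow> 'a) set monoid" where
  "HH1 R A = derivation_group R A Mod inner_derivations A"

end

theory Submission
  imports Defs
begin

text \<open>Let \<open>a\<close> be the class of a transitive \<open>G\<close>-set \<open>U\<close> of size \<open>m\<close>. Then \<open>a\<^sup>2 = n a + l\<close>, where \<open>n\<close>
  divides the order of \<open>G\<close> and all orbits in \<open>l\<close> have more than \<open>m\<close> elements; the same holds for
  the orbits in \<open>l a\<close>. By downward induction on \<open>m\<close>, a derivation \<open>d\<close> vanishes on \<open>l\<close> and on
  \<open>l a\<close>, so that \<open>y = d a\<close> satisfies \<open>l y = 0\<close> and \<open>2 a y = n y\<close>. Multiplying by \<open>a\<close> gives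
  \<open>2 n a y = n a y\<close>. The Burnside algebra has no \<open>n\<close>-torsion, because it has the classes of
  transitive \<open>G\<close>-sets as an \<open>R\<close>-basis. Hence \<open>a y = 0\<close>, then \<open>n y = 0\<close> and \<open>y = 0\<close>.\<close>

section \<open>The Grothendieck ring of a commutative semiring\<close>

text \<open>When the order of \<open>G\<close> is odd, \<open>R\<close> may have 2-torsion, so 2
  must never be divided out. Multiplying by \<open>a\<close> serves this purpose: it produces the
  same element once and twice, so that plain subtraction removes the 2 and only torsion by
  \<open>n\<close> is left to exclude.

  The number \<open>n\<close> counts the points of \<open>U\<close> that share a given stabilizer H,
  and is thus the index of H in its normalizer. Sets of points with equal stabilizers cut
  \<open>U\<close> into blocks of size \<open>n\<close>, hence \<open>n\<close> divides the size of
  \<open>U\<close>, which divides the order of \<open>G\<close>.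

  Torsion is controlled through coordinates. The number of orbits of a given type is additive on
  G-sets and extends to the Burnside ring, and every element is recovered from these integers. The
  recovery formula is an identity between additive maps, so it survives tensoring with
  \<open>R\<close> and reduces torsion in the algebra to torsion in \<open>R\<close>.\<close>

locale csemiring = semiring S + comm_monoid S for S (structure)

text \<open>The operations of \<open>grothendieck_ring\<close> are unions over all representatives.
  Such a union collapses to one class once all pairs of representatives give that class and some
  pair exists.\<close>

lemma UN_pair_const:
  assumes "(a, b) \<in> P" "(c, d) \<in> Q"
    and "\<And>a b c d. (a, b) \<in> P \<Longrightarrow> (c, d) \<in> Q \<Longrightarrow> F a b c d = C"
  shows "(\<Union>(a, b)\<in>P. \<Union>(c, d)\<in>Q. F a b c d) = C"
  using assms by blast

context csemiring
begin

abbreviation K where "K \<equiv> grothendieck_ring S"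

definition groth :: "'a \<Rightarrow> 'a \<Rightarrow> ('a \<times> 'a) set" where
  "groth a b = grothendieck_rel S `` {(a, b)}"

lemma equiv_grothendieck_rel: "equiv (carrier S \<times> carrier S) (grothendieck_rel S)"
proof (rule equivI)
  show "grothendieck_rel S \<subseteq> (carrier S \<times> carrier S) \<times> (carrier S \<times> carrier S)"
    by (auto simp: grothendieck_rel_def)
  show "refl_on (carrier S \<times> carrier S) (grothendieck_rel S)"
    by (auto simp: grothendieck_rel_def refl_on_def)
  show "sym (grothendieck_rel S)"
    by (rule symI) (auto simp: grothendieck_rel_def, rule bexI, erule sym)
  show "trans (grothendieck_rel S)"
  proof (rule transI, clarify)
    fix a b c d e f
    assume "((a, b), (c, d)) \<in> grothendieck_rel S" "((c, d), (e, f)) \<in> grothendieck_rel S"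
    then obtain k l where c [simp]: "a \<in> carrier S" "b \<in> carrier S" "c \<in> carrier S" "d \<in> carrier S"
      "e \<in> carrier S" "f \<in> carrier S" "k \<in> carrier S" "l \<in> carrier S"
      and k: "a \<oplus> d \<oplus> k = c \<oplus> b \<oplus> k" and l: "c \<oplus> f \<oplus> l = e \<oplus> d \<oplus> l"
      by (auto simp: grothendieck_rel_def)
    \<comment> \<open>Adding the two relations leaves the middle pair \<open>c\<close>,
      \<open>d\<close> on both sides. Without cancellation it is absorbed, together with
      \<open>k\<close> and \<open>l\<close>, into the stabilizing summand.\<close>
    have "a \<oplus> f \<oplus> (c \<oplus> d \<oplus> k \<oplus> l) = (a \<oplus> d \<oplus> k) \<oplus> (c \<oplus> f \<oplus> l)"
      by (simp add: a_ac)
    also have "\<dots> = e \<oplus> b \<oplus> (c \<oplus> d \<oplus> k \<oplus> l)"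
      unfolding k l by (simp add: a_ac)
    finally show "((a, b), (e, f)) \<in> grothendieck_rel S"
      unfolding grothendieck_rel_def by (auto intro!: bexI[of _ "c \<oplus> d \<oplus> k \<oplus> l"])
  qed
qed

lemma groth_eq_iff:
  assumes "a \<in> carrier S" "b \<in> carrier S" "c \<in> carrier S" "d \<in> carrier S"
  shows "groth a b = groth c d \<longleftrightarrow> (\<exists>k\<in>carrier S. a \<oplus> d \<oplus> k = c \<oplus> b \<oplus> k)"
  unfolding groth_def using assms
  by (subst eq_equiv_class_iff[OF equiv_grothendieck_rel]) (auto simp: grothendieck_rel_def)

lemma groth_eqI:
  assumes "a \<in> carrier S" "b \<in> carrier S" "c \<in> carrier S" "d \<in> carrier S" "a \<oplus> d = c \<oplus> b"
  shows "groth a b = groth c d"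
  using assms by (auto simp: groth_eq_iff intro!: bexI[of _ \<zero>])

lemma groth_mem_iff:
  "(c, d) \<in> groth a b \<longleftrightarrow> a \<in> carrier S \<and> b \<in> carrier S \<and> c \<in> carrier S \<and> d \<in> carrier S \<and> groth a b = groth c d"
proof -
  have "(c, d) \<in> groth a b \<longleftrightarrow> ((a, b), (c, d)) \<in> grothendieck_rel S"
    by (simp add: groth_def)
  also have "\<dots> \<longleftrightarrow> a \<in> carrier S \<and> b \<in> carrier S \<and> c \<in> carrier S \<and> d \<in> carrier S \<and> groth a b = groth c d"
    unfolding groth_def equiv_class_eq_iff[OF equiv_grothendieck_rel] by blast
  finally show ?thesis .
qed

lemma groth_closed: "a \<in> carrier S \<Longrightarrow> b \<in> carrier S \<Longrightarrow> groth a b \<in> carrier K"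
  by (auto simp: grothendieck_ring_def groth_def intro: quotientI)

lemma groth_carrierE:
  assumes "P \<in> carrier K"
  obtains a b where "a \<in> carrier S" "b \<in> carrier S" "P = groth a b"
proof -
  have "P \<in> (carrier S \<times> carrier S) // grothendieck_rel S"
    using assms by (simp add: grothendieck_ring_def)
  then show ?thesis using that unfolding groth_def by (elim quotientE) blast
qed

lemma groth_add:
  assumes [simp]: "a \<in> carrier S" "b \<in> carrier S" "c \<in> carrier S" "d \<in> carrier S"
  shows "groth a b \<oplus>\<^bsub>K\<^esub> groth c d = groth (a \<oplus> c) (b \<oplus> d)"
proof -
  have "groth (a' \<oplus> c') (b' \<oplus> d') = groth (a \<oplus> c) (b \<oplus> d)"
    if "(a', b') \<in> groth a b" "(c', d') \<in> groth c d" for a' b' c' d'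
  proof -
    from that obtain k l where [simp]: "a' \<in> carrier S" "b' \<in> carrier S" "c' \<in> carrier S" "d' \<in> carrier S"
      "k \<in> carrier S" "l \<in> carrier S"
      and k: "a \<oplus> b' \<oplus> k = a' \<oplus> b \<oplus> k" and l: "c \<oplus> d' \<oplus> l = c' \<oplus> d \<oplus> l"
      by (auto simp: groth_mem_iff groth_eq_iff)
    have "a' \<oplus> c' \<oplus> (b \<oplus> d) \<oplus> (k \<oplus> l) = (a' \<oplus> b \<oplus> k) \<oplus> (c' \<oplus> d \<oplus> l)"
      by (simp add: a_ac)
    also have "\<dots> = a \<oplus> c \<oplus> (b' \<oplus> d') \<oplus> (k \<oplus> l)"
      unfolding k[symmetric] l[symmetric] by (simp add: a_ac)
    finally show ?thesis by (auto simp: groth_eq_iff intro!: bexI[of _ "k \<oplus> l"])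
  qed
  moreover have "(a, b) \<in> groth a b" "(c, d) \<in> groth c d" by (simp_all add: groth_mem_iff)
  ultimately show ?thesis
    unfolding grothendieck_ring_def ring.simps monoid.simps groth_def[symmetric]
    by (intro UN_pair_const)
qed

lemma groth_mult:
  assumes [simp]: "a \<in> carrier S" "b \<in> carrier S" "c \<in> carrier S" "d \<in> carrier S"
  shows "groth a b \<otimes>\<^bsub>K\<^esub> groth c d = groth (a \<otimes> c \<oplus> b \<otimes> d) (a \<otimes> d \<oplus> b \<otimes> c)"
proof -
  \<comment> \<open>Representatives change in one factor at a time. The relation for the first
    factor is multiplied by \<open>c\<close> and, with sides exchanged, by \<open>d\<close>, whence
    the stabilizing summand made of \<open>k\<close> times \<open>c\<close> and \<open>k\<close>
    times \<open>d\<close>. The second factor follows by commutativity.\<close>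
  have left: "groth (a' \<otimes> c \<oplus> b' \<otimes> d) (a' \<otimes> d \<oplus> b' \<otimes> c) = groth (a \<otimes> c \<oplus> b \<otimes> d) (a \<otimes> d \<oplus> b \<otimes> c)"
    if "(a', b') \<in> groth a b" and [simp]: "c \<in> carrier S" "d \<in> carrier S" for a' b' a b c d
  proof -
    from that(1) obtain k where [simp]: "a' \<in> carrier S" "b' \<in> carrier S" "a \<in> carrier S" "b \<in> carrier S" "k \<in> carrier S"
      and k: "a \<oplus> b' \<oplus> k = a' \<oplus> b \<oplus> k"
      by (auto simp: groth_mem_iff groth_eq_iff)
    have "a' \<otimes> c \<oplus> b' \<otimes> d \<oplus> (a \<otimes> d \<oplus> b \<otimes> c) \<oplus> (k \<otimes> c \<oplus> k \<otimes> d)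
        = (a' \<oplus> b \<oplus> k) \<otimes> c \<oplus> (a \<oplus> b' \<oplus> k) \<otimes> d"
      by (simp add: l_distr a_ac)
    also have "\<dots> = (a \<oplus> b' \<oplus> k) \<otimes> c \<oplus> (a' \<oplus> b \<oplus> k) \<otimes> d"
      unfolding k ..
    also have "\<dots> = a \<otimes> c \<oplus> b \<otimes> d \<oplus> (a' \<otimes> d \<oplus> b' \<otimes> c) \<oplus> (k \<otimes> c \<oplus> k \<otimes> d)"
      by (simp add: l_distr a_ac)
    finally show ?thesis by (auto simp: groth_eq_iff intro!: bexI[of _ "k \<otimes> c \<oplus> k \<otimes> d"])
  qed
  have "groth (a' \<otimes> c' \<oplus> b' \<otimes> d') (a' \<otimes> d' \<oplus> b' \<otimes> c') = groth (a \<otimes> c \<oplus> b \<otimes> d) (a \<otimes> d \<oplus> b \<otimes> c)"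
    if "(a', b') \<in> groth a b" "(c', d') \<in> groth c d" for a' b' c' d'
  proof -
    have [simp]: "a' \<in> carrier S" "b' \<in> carrier S" "c' \<in> carrier S" "d' \<in> carrier S"
      using that by (auto simp: groth_mem_iff)
    have "groth (c' \<otimes> a \<oplus> d' \<otimes> b) (c' \<otimes> b \<oplus> d' \<otimes> a) = groth (c \<otimes> a \<oplus> d \<otimes> b) (c \<otimes> b \<oplus> d \<otimes> a)"
      using left[OF that(2)] by simp
    then show ?thesis
      using left[OF that(1), of c' d'] by (simp add: m_comm a_comm)
  qed
  moreover have "(a, b) \<in> groth a b" "(c, d) \<in> groth c d" by (simp_all add: groth_mem_iff)
  ultimately show ?thesis
    unfolding grothendieck_ring_def ring.simps monoid.simps groth_def[symmetric]
    by (intro UN_pair_const)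
qed

lemma groth_zero: "\<zero>\<^bsub>K\<^esub> = groth \<zero> \<zero>"
  and groth_one: "\<one>\<^bsub>K\<^esub> = groth \<one> \<zero>"
  by (simp_all add: grothendieck_ring_def groth_def)

lemma cring_grothendieck_ring: "cring K"
proof (rule cringI)
  note [simp] = groth_add groth_mult groth_zero groth_one groth_closed
  show "abelian_group K"
  proof (rule abelian_groupI; (elim groth_carrierE)?; simp)
    show "\<exists>y\<in>carrier K. y \<oplus>\<^bsub>K\<^esub> groth a b = groth \<zero> \<zero>"
      if [simp]: "a \<in> carrier S" "b \<in> carrier S" for a b
      by (rule bexI[of _ "groth b a"], simp_all, rule groth_eqI) (simp_all add: a_comm)
  qed (auto intro!: groth_eqI simp: a_ac)
  show "comm_monoid K"
    by (rule comm_monoidI; (elim groth_carrierE)?; simp)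
      (auto intro!: groth_eqI simp: a_ac m_ac l_distr r_distr)
  show "(x \<oplus>\<^bsub>K\<^esub> y) \<otimes>\<^bsub>K\<^esub> z = x \<otimes>\<^bsub>K\<^esub> z \<oplus>\<^bsub>K\<^esub> y \<otimes>\<^bsub>K\<^esub> z"
    if "x \<in> carrier K" "y \<in> carrier K" "z \<in> carrier K" for x y z
    using that by (elim groth_carrierE) (auto intro!: groth_eqI simp: a_ac l_distr)
qed

lemma groth_minus:
  assumes [simp]: "a \<in> carrier S" "b \<in> carrier S"
  shows "groth a b = groth a \<zero> \<ominus>\<^bsub>K\<^esub> groth b \<zero>"
proof -
  interpret K: cring K by (rule cring_grothendieck_ring)
  have "\<ominus>\<^bsub>K\<^esub> groth b \<zero> = groth \<zero> b"
    by (rule sym, rule K.sum_zero_eq_neg, simp_all add: groth_add groth_closed groth_zero, rule groth_eqI) simp_all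
  then show ?thesis by (simp add: a_minus_def groth_add)
qed

text \<open>Universal property of the Grothendieck group for the target \<open>int\<close>. The
  extension is well defined because the stabilizing summand cancels among integers. It turns orbit
  counts into coordinates on the Burnside ring.\<close>

lemma ex_groth_extension:
  fixes c :: "'a \<Rightarrow> int"
  assumes add: "\<And>a b. a \<in> carrier S \<Longrightarrow> b \<in> carrier S \<Longrightarrow> c (a \<oplus> b) = c a + c b"
  obtains C where "\<And>P Q. P \<in> carrier K \<Longrightarrow> Q \<in> carrier K \<Longrightarrow> C (P \<oplus>\<^bsub>K\<^esub> Q) = C P + (C Q :: int)"
    "\<And>a. a \<in> carrier S \<Longrightarrow> C (groth a \<zero>) = c a"
proof -
  define C where "C P = (let p = SOME p. p \<in> P in c (fst p) - c (snd p))" for P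
  have C: "C (groth a b) = c a - c b" if [simp]: "a \<in> carrier S" "b \<in> carrier S" for a b
  proof -
    have "(a, b) \<in> groth a b" by (simp add: groth_mem_iff)
    then have "(SOME p. p \<in> groth a b) \<in> groth a b" by (rule someI)
    moreover obtain a' b' where p: "(SOME p. p \<in> groth a b) = (a', b')" by fastforce
    ultimately obtain k where [simp]: "a' \<in> carrier S" "b' \<in> carrier S" "k \<in> carrier S"
      and "a \<oplus> b' \<oplus> k = a' \<oplus> b \<oplus> k"
      by (auto simp: groth_mem_iff groth_eq_iff)
    then have "c (a \<oplus> b' \<oplus> k) = c (a' \<oplus> b \<oplus> k)" by simp
    then show ?thesis by (simp add: C_def p add)
  qed
  have "c \<zero> = 0" using add[of \<zero> \<zero>] by simp
  then show ?thesis
    by (intro that[of C]) (auto elim!: groth_carrierE simp: C groth_add add)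
qed

end


section \<open>The semiring of finite \<open>G\<close>-sets\<close>

text \<open>\<open>group_action\<close> asks for a homomorphism into \<open>BijGroup\<close>, that
  is, for extensional bijections. Bijectivity follows from the pointwise laws, since the inverse
  group element acts as a two-sided inverse.\<close>

lemma group_actionI:
  assumes "group G"
    and closed: "\<And>g x. g \<in> carrier G \<Longrightarrow> x \<in> E \<Longrightarrow> \<phi> g x \<in> E"
    and ext: "\<And>g. g \<in> carrier G \<Longrightarrow> \<phi> g \<in> extensional E"
    and one: "\<And>x. x \<in> E \<Longrightarrow> \<phi> \<one>\<^bsub>G\<^esub> x = x"
    and mult: "\<And>g h x. g \<in> carrier G \<Longrightarrow> h \<in> carrier G \<Longrightarrow> x \<in> E \<Longrightarrow> \<phi> (g \<otimes>\<^bsub>G\<^esub> h) x = \<phi> g (\<phi> h x)"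
  shows "group_action G E \<phi>"
proof -
  interpret group G by fact
  have bij: "\<phi> g \<in> Bij E" if g: "g \<in> carrier G" for g
  proof -
    have "bij_betw (\<phi> g) E E"
      by (rule bij_betw_byWitness[where f' = "\<phi> (inv\<^bsub>G\<^esub> g)"])
        (use g closed one mult[symmetric] in auto)
    then show ?thesis using ext[OF g] by (simp add: Bij_def)
  qed
  have "\<phi> (g \<otimes>\<^bsub>G\<^esub> h) = compose E (\<phi> g) (\<phi> h)" if "g \<in> carrier G" "h \<in> carrier G" for g h
    by (rule extensionalityI[where A = E]) (use that ext mult in \<open>auto simp: compose_eq\<close>)
  then have "\<phi> \<in> hom G (BijGroup E)"
    using bij by (auto simp: hom_def BijGroup_def)
  then show ?thesis
    by (intro group_action.intro group_hom.intro group_hom_axioms.intro group_BijGroup \<open>group G\<close>)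
qed

lemma finite_gsetI:
  assumes "group G" "finite E"
    and "\<And>g x. g \<in> carrier G \<Longrightarrow> x \<in> E \<Longrightarrow> \<phi> g x \<in> E"
    and "\<And>x. x \<in> E \<Longrightarrow> \<phi> \<one>\<^bsub>G\<^esub> x = x"
    and "\<And>g h x. g \<in> carrier G \<Longrightarrow> h \<in> carrier G \<Longrightarrow> x \<in> E \<Longrightarrow> \<phi> (g \<otimes>\<^bsub>G\<^esub> h) x = \<phi> g (\<phi> h x)"
  shows "finite_gset G (E, \<lambda>g. \<lambda>x\<in>E. \<phi> g x)"
  unfolding finite_gset_def
  using assms group.is_monoid[THEN monoid.one_closed, OF assms(1)]
    group.is_monoid[THEN monoid.m_closed, OF assms(1)]
  by (auto intro!: group_actionI)

lemma gset_isoI: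
  assumes "bij_betw f (fst U) (fst V)"
    and "\<And>g x. g \<in> carrier G \<Longrightarrow> x \<in> fst U \<Longrightarrow> f (snd U g x) = snd V g (f x)"
  shows "gset_iso G U V"
  using assms unfolding gset_iso_def by blast

lemma gset_iso_trans:
  assumes "gset_iso G U V" "gset_iso G V W"
  shows "gset_iso G U W"
proof -
  obtain f g where fg: "bij_betw f (fst U) (fst V)" "bij_betw g (fst V) (fst W)"
    "\<forall>a\<in>carrier G. \<forall>x\<in>fst U. f (snd U a x) = snd V a (f x)"
    "\<forall>a\<in>carrier G. \<forall>x\<in>fst V. g (snd V a x) = snd W a (g x)"
    using assms unfolding gset_iso_def by blast
  show ?thesis
    by (rule gset_isoI[OF bij_betw_trans[OF fg(1,2)]]) (use fg in \<open>auto simp: bij_betw_apply\<close>)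
qed

context group
begin

lemma finite_gset_finite: "finite_gset G U \<Longrightarrow> finite (fst U)"
  by (simp add: finite_gset_def)

lemma gset_closed: "finite_gset G U \<Longrightarrow> g \<in> carrier G \<Longrightarrow> x \<in> fst U \<Longrightarrow> snd U g x \<in> fst U"
  unfolding finite_gset_def by (meson group_action.element_image)

lemma gset_one: "finite_gset G U \<Longrightarrow> x \<in> fst U \<Longrightarrow> snd U \<one> x = x"
  unfolding finite_gset_def by (metis group_action.id_eq_one restrict_apply')

lemma gset_mult:
  "finite_gset G U \<Longrightarrow> g \<in> carrier G \<Longrightarrow> h \<in> carrier G \<Longrightarrow> x \<in> fst U \<Longrightarrow>
     snd U (g \<otimes> h) x = snd U g (snd U h x)"
  unfolding finite_gset_def by (meson group_action.composition_rule)

lemma gset_inv_left: "finite_gset G U \<Longrightarrow> g \<in> carrier G \<Longrightarrow> x \<in> fst U \<Longrightarrow> snd U (inv g) (snd U g x) = x"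
  using gset_mult[of U "inv g" g x] by (simp add: gset_one)

lemma gset_inv_right: "finite_gset G U \<Longrightarrow> g \<in> carrier G \<Longrightarrow> x \<in> fst U \<Longrightarrow> snd U g (snd U (inv g) x) = x"
  using gset_mult[of U g "inv g" x] by (simp add: gset_one)

lemma gset_iso_sym:
  assumes U: "finite_gset G U" and "gset_iso G U V"
  shows "gset_iso G V U"
proof -
  obtain f where f: "bij_betw f (fst U) (fst V)"
    "\<forall>a\<in>carrier G. \<forall>x\<in>fst U. f (snd U a x) = snd V a (f x)"
    using assms unfolding gset_iso_def by blast
  show ?thesis
  proof (rule gset_isoI)
    show "bij_betw (inv_into (fst U) f) (fst V) (fst U)"
      using f(1) by (rule bij_betw_inv_into)
    fix g y assume g: "g \<in> carrier G" and "y \<in> fst V"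
    then obtain x where x: "x \<in> fst U" "y = f x"
      using f(1) by (auto simp: bij_betw_def)
    then have "snd V g y = f (snd U g x)" using f(2) g by simp
    then show "inv_into (fst U) f (snd V g y) = snd U g (inv_into (fst U) f y)"
      using x f(1) g U by (simp add: bij_betw_def gset_closed)
  qed
qed

text \<open>The two G-sets may live on different types while their classes have the same type. Every
  isomorphism below can therefore be given on sums, products and subsets directly, without renaming
  points by natural numbers.\<close>

lemma gset_class_eqI:
  assumes "finite_gset G U" "gset_iso G U V"
  shows "gset_class G U = gset_class G V"
  using assms gset_iso_sym[OF assms] unfolding gset_class_def by (auto intro: gset_iso_trans)

text \<open>The action is carried along an enumeration of the finite underlying set. This makes
  every class nonempty, on which all computations with representatives rest.\<close>

lemma ex_nat_gset:
  assumes U: "finite_gset G U"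
  obtains Z :: "('a, nat) gset" where "finite_gset G Z" "gset_iso G Z U" "gset_class G Z = gset_class G U"
proof -
  obtain f where f: "bij_betw f (fst U) {0..<card (fst U)}"
    using ex_bij_betw_finite_nat finite_gset_finite[OF U] by blast
  define h where "h = inv_into (fst U) f"
  have h: "bij_betw h {0..<card (fst U)} (fst U)"
    using f unfolding h_def by (rule bij_betw_inv_into)
  have fh: "f x \<in> {0..<card (fst U)}" "h (f x) = x" if "x \<in> fst U" for x
    using f that by (auto simp: bij_betw_def h_def)
  have hf: "h n \<in> fst U" "f (h n) = n" if "n < card (fst U)" for n
    using f h that by (auto simp: bij_betw_def h_def f_inv_into_f)
  define Z where "Z = ({0..<card (fst U)}, \<lambda>g. \<lambda>n\<in>{0..<card (fst U)}. f (snd U g (h n)))"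
  have Z: "finite_gset G Z"
    unfolding Z_def
    by (rule finite_gsetI) (use U fh hf in \<open>auto simp: gset_closed gset_one gset_mult is_group\<close>)
  moreover have iso: "gset_iso G Z U"
    by (rule gset_isoI[of h]) (use h U hf fh in \<open>auto simp: Z_def gset_closed\<close>)
  moreover note gset_class_eqI[OF Z iso]
  ultimately show ?thesis by (rule that)
qed

lemma gset_class_closed:
  assumes "finite_gset G U"
  shows "gset_class G U \<in> carrier (gset_semiring G)"
proof -
  obtain Z :: "('a, nat) gset" where "finite_gset G Z" "gset_class G Z = gset_class G U"
    using ex_nat_gset[OF assms] by metis
  then show ?thesis unfolding gset_semiring_def partial_object.simps by blast
qed

lemma gset_carrierE:
  assumes "A \<in> carrier (gset_semiring G)"
  obtains U :: "('a, nat) gset" where "finite_gset G U" "A = gset_class G U"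
  using assms unfolding gset_semiring_def partial_object.simps by blast

section \<open>Sums and products of finite G-sets and of their classes\<close>

lemma finite_gset_sum:
  "finite_gset G U \<Longrightarrow> finite_gset G V \<Longrightarrow> finite_gset G (gset_sum U V)"
  unfolding gset_sum_def
  by (rule finite_gsetI) (auto simp: is_group finite_gset_finite gset_closed gset_one gset_mult)

lemma finite_gset_prod:
  "finite_gset G U \<Longrightarrow> finite_gset G V \<Longrightarrow> finite_gset G (gset_prod U V)"
  unfolding gset_prod_def
  by (rule finite_gsetI) (auto simp: is_group finite_gset_finite gset_closed gset_one gset_mult)

lemma finite_gset_empty: "finite_gset G gset_empty"
  unfolding gset_empty_def by (rule finite_gsetI) (auto simp: is_group)

lemma finite_gset_point: "finite_gset G gset_point"
  unfolding gset_point_def by (rule finite_gsetI) (auto simp: is_group)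

lemma gset_iso_sum:
  assumes "gset_iso G U U'" "gset_iso G V V'"
  shows "gset_iso G (gset_sum U V) (gset_sum U' V')"
proof -
  obtain f g where f: "bij_betw f (fst U) (fst U')" "\<forall>a\<in>carrier G. \<forall>x\<in>fst U. f (snd U a x) = snd U' a (f x)"
    and g: "bij_betw g (fst V) (fst V')" "\<forall>a\<in>carrier G. \<forall>x\<in>fst V. g (snd V a x) = snd V' a (g x)"
    using assms unfolding gset_iso_def by blast
  have "bij_betw (map_sum f g) (Sum_Type.Plus (fst U) (fst V)) (Sum_Type.Plus (fst U') (fst V'))"
    by (rule bij_betw_byWitness[where f' = "map_sum (inv_into (fst U) f) (inv_into (fst V) g)"])
      (use f(1) g(1) in \<open>auto simp: bij_betw_def f_inv_into_f inv_into_into\<close>)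
  then show ?thesis
    by (intro gset_isoI[of "map_sum f g"]) (use f g in \<open>auto simp: gset_sum_def bij_betw_apply\<close>)
qed

lemma gset_iso_prod:
  assumes "gset_iso G U U'" "gset_iso G V V'"
  shows "gset_iso G (gset_prod U V) (gset_prod U' V')"
proof -
  obtain f g where f: "bij_betw f (fst U) (fst U')" "\<forall>a\<in>carrier G. \<forall>x\<in>fst U. f (snd U a x) = snd U' a (f x)"
    and g: "bij_betw g (fst V) (fst V')" "\<forall>a\<in>carrier G. \<forall>x\<in>fst V. g (snd V a x) = snd V' a (g x)"
    using assms unfolding gset_iso_def by blast
  have "bij_betw (map_prod f g) (fst U \<times> fst V) (fst U' \<times> fst V')"
    using f(1) g(1) by (rule bij_betw_map_prod)
  then show ?thesis
    by (intro gset_isoI[of "map_prod f g"]) (use f g in \<open>auto simp: gset_prod_def bij_betw_apply\<close>)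
qed

lemma gset_classD:
  assumes "U' \<in> gset_class G U"
  shows "finite_gset G U'" "gset_iso G U' U"
  using assms by (auto simp: gset_class_def)

lemma gset_class_nonempty: "finite_gset G U \<Longrightarrow> gset_class G U \<noteq> {}"
  by (rule ex_nat_gset[of U]) (auto simp: gset_class_def)

lemma gset_class_add:
  assumes "finite_gset G U" "finite_gset G V"
  shows "gset_class G U \<oplus>\<^bsub>gset_semiring G\<^esub> gset_class G V = gset_class G (gset_sum U V)"
proof -
  have "gset_class G (gset_sum U' V') = gset_class G (gset_sum U V)"
    if "U' \<in> gset_class G U" "V' \<in> gset_class G V" for U' V'
    by (intro gset_class_eqI finite_gset_sum gset_iso_sum)
      (use that[THEN gset_classD(1)] that[THEN gset_classD(2)] in auto)
  then show ?thesis
    using gset_class_nonempty[OF assms(1)] gset_class_nonempty[OF assms(2)]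
    by (auto simp: gset_semiring_def)
qed

lemma gset_class_mult:
  assumes "finite_gset G U" "finite_gset G V"
  shows "gset_class G U \<otimes>\<^bsub>gset_semiring G\<^esub> gset_class G V = gset_class G (gset_prod U V)"
proof -
  have "gset_class G (gset_prod U' V') = gset_class G (gset_prod U V)"
    if "U' \<in> gset_class G U" "V' \<in> gset_class G V" for U' V'
    by (intro gset_class_eqI finite_gset_prod gset_iso_prod)
      (use that[THEN gset_classD(1)] that[THEN gset_classD(2)] in auto)
  then show ?thesis
    using gset_class_nonempty[OF assms(1)] gset_class_nonempty[OF assms(2)]
    by (auto simp: gset_semiring_def)
qed

lemma gset_class_zero: "\<zero>\<^bsub>gset_semiring G\<^esub> = gset_class G gset_empty"
  and gset_class_one: "\<one>\<^bsub>gset_semiring G\<^esub> = gset_class G gset_point"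
  by (simp_all add: gset_semiring_def)

end

text \<open>Each semiring law is the canonical bijection between the two G-sets that it compares.
  The fact \<open>iso\<close> turns mutually inverse maps, the first of them equivariant, into an
  equality of classes.\<close>

lemma (in group) csemiring_gset_semiring: "csemiring (gset_semiring G)"
proof -
  note [simp] = gset_class_add gset_class_mult gset_class_zero gset_class_one gset_class_closed
    finite_gset_sum finite_gset_prod finite_gset_empty finite_gset_point
  note defs = gset_sum_def gset_prod_def gset_empty_def gset_point_def
  have iso: "gset_class G U = gset_class G V"
    if "finite_gset G U" "\<And>x. x \<in> fst U \<Longrightarrow> f x \<in> fst V \<and> f' (f x) = x"
      "\<And>y. y \<in> fst V \<Longrightarrow> f' y \<in> fst U \<and> f (f' y) = y"
      "\<And>g x. g \<in> carrier G \<Longrightarrow> x \<in> fst U \<Longrightarrow> f (snd U g x) = snd V g (f x)"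
    for U :: "('a, 'u) gset" and V :: "('a, 'v) gset" and f f'
    by (intro gset_class_eqI gset_isoI[of f] bij_betw_byWitness[where f' = f']) (use that in auto)
  have add_assoc: "gset_class G (gset_sum (gset_sum U V) W) = gset_class G (gset_sum U (gset_sum V W))"
    if [simp]: "finite_gset G U" "finite_gset G V" "finite_gset G W"
    for U V W :: "('a, nat) gset"
    by (rule iso[of _ "case_sum (case_sum Inl (Inr \<circ> Inl)) (Inr \<circ> Inr)" _
        "case_sum (Inl \<circ> Inl) (case_sum (Inl \<circ> Inr) Inr)"], simp)
      (auto simp: defs gset_closed)
  have mult_assoc: "gset_class G (gset_prod (gset_prod U V) W) = gset_class G (gset_prod U (gset_prod V W))"
    if [simp]: "finite_gset G U" "finite_gset G V" "finite_gset G W"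
    for U V W :: "('a, nat) gset"
    by (rule iso[of _ "\<lambda>((x, y), z). (x, y, z)" _
        "\<lambda>(x, y, z). ((x, y), z)"], simp)
      (auto simp: defs gset_closed)
  have distr_l: "gset_class G (gset_prod (gset_sum U V) W) = gset_class G (gset_sum (gset_prod U W) (gset_prod V W))"
    if [simp]: "finite_gset G U" "finite_gset G V" "finite_gset G W"
    for U V W :: "('a, nat) gset"
    by (rule iso[of _ "\<lambda>(x, z). map_sum (\<lambda>x. (x, z)) (\<lambda>y. (y, z)) x" _
        "case_sum (\<lambda>(x, z). (Inl x, z)) (\<lambda>(x, z). (Inr x, z))"], simp)
      (auto simp: defs gset_closed)
  have distr_r: "gset_class G (gset_prod W (gset_sum U V)) = gset_class G (gset_sum (gset_prod W U) (gset_prod W V))"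
    if [simp]: "finite_gset G U" "finite_gset G V" "finite_gset G W"
    for U V W :: "('a, nat) gset"
    by (rule iso[of _ "\<lambda>(z, x). map_sum (\<lambda>x. (z, x)) (\<lambda>y. (z, y)) x" _
        "case_sum (\<lambda>(z, x). (z, Inl x)) (\<lambda>(z, x). (z, Inr x))"], simp)
      (auto simp: defs gset_closed)
  have add_comm: "gset_class G (gset_sum U V) = gset_class G (gset_sum V U)"
    if [simp]: "finite_gset G U" "finite_gset G V"
    for U V :: "('a, nat) gset"
    by (rule iso[of _ "case_sum Inr Inl" _ "case_sum Inr Inl"], simp)
      (auto simp: defs gset_closed)
  have mult_comm: "gset_class G (gset_prod U V) = gset_class G (gset_prod V U)"
    if [simp]: "finite_gset G U" "finite_gset G V"
    for U V :: "('a, nat) gset"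
    by (rule iso[of _ prod.swap _ prod.swap], simp)
      (auto simp: defs gset_closed)
  \<comment> \<open>Here and in the laws on \<open>gset_empty\<close> below,
    \<open>undefined\<close> only fills in values at points that an empty set does not have.\<close>
  have zero_l: "gset_class G (gset_sum gset_empty U) = gset_class G U"
    if [simp]: "finite_gset G U"
    for U :: "('a, nat) gset"
    by (rule iso[of _ "case_sum undefined id" _ Inr], simp)
      (auto simp: defs gset_closed)
  have zero_r: "gset_class G (gset_sum U gset_empty) = gset_class G U"
    if [simp]: "finite_gset G U"
    for U :: "('a, nat) gset"
    by (rule iso[of _ "case_sum id undefined" _ Inl], simp)
      (auto simp: defs gset_closed)
  have one_l: "gset_class G (gset_prod gset_point U) = gset_class G U"
    if [simp]: "finite_gset G U"
    for U :: "('a, nat) gset"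
    by (rule iso[of _ snd _ "\<lambda>x. ((), x)"], simp)
      (auto simp: defs gset_closed)
  have one_r: "gset_class G (gset_prod U gset_point) = gset_class G U"
    if [simp]: "finite_gset G U"
    for U :: "('a, nat) gset"
    by (rule iso[of _ fst _ "\<lambda>x. (x, ())"], simp)
      (auto simp: defs gset_closed)
  have null_l: "gset_class G (gset_prod gset_empty U) = gset_class G gset_empty"
    if [simp]: "finite_gset G U"
    for U :: "('a, nat) gset"
    by (rule iso[of _ fst _ "\<lambda>x. (x, undefined)"], simp)
      (auto simp: defs gset_closed)
  have null_r: "gset_class G (gset_prod U gset_empty) = gset_class G gset_empty"
    if [simp]: "finite_gset G U"
    for U :: "('a, nat) gset"
    by (rule iso[of _ snd _ "\<lambda>x. (undefined, x)"], simp)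
      (auto simp: defs gset_closed)
  show ?thesis
    by (unfold_locales; (simp only: monoid.simps partial_object.simps)?; (elim gset_carrierE)?;
        simp add: add_assoc mult_assoc distr_l distr_r zero_l zero_r one_l one_r null_l null_r; (intro add_comm mult_comm; assumption)?)
qed


section \<open>Additive maps and tensor products\<close>

lemma abelian_group_hom_addI:
  assumes "abelian_group G" "abelian_group H"
    and "\<And>x. x \<in> carrier G \<Longrightarrow> h x \<in> carrier H"
    and "\<And>x y. x \<in> carrier G \<Longrightarrow> y \<in> carrier G \<Longrightarrow> h (x \<oplus>\<^bsub>G\<^esub> y) = h x \<oplus>\<^bsub>H\<^esub> h y"
  shows "abelian_group_hom G H h"
  using assms
  by (intro abelian_group_homI group_hom.intro group_hom_axioms.intro)
    (auto simp: hom_def abelian_group.a_group)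

context abelian_group_hom
begin

lemma hom_minus: "x \<in> carrier G \<Longrightarrow> y \<in> carrier G \<Longrightarrow> h (x \<ominus>\<^bsub>G\<^esub> y) = h x \<ominus>\<^bsub>H\<^esub> h y"
  by (simp add: a_minus_def)

lemma hom_add_pow_int: "x \<in> carrier G \<Longrightarrow> h ([(k :: int)] \<cdot>\<^bsub>G\<^esub> x) = [k] \<cdot>\<^bsub>H\<^esub> h x"
  using group_hom.hom_int_pow[OF a_group_hom, of x k] by (simp add: add_pow_def)

lemma hom_add_pow_nat: "x \<in> carrier G \<Longrightarrow> h ([(k :: nat)] \<cdot>\<^bsub>G\<^esub> x) = [k] \<cdot>\<^bsub>H\<^esub> h x"
  using group_hom.hom_nat_pow[OF a_group_hom, of x k] by (simp add: add_pow_def)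

lemma hom_finsum:
  "f \<in> A \<rightarrow> carrier G \<Longrightarrow> h (finsum G f A) = finsum H (\<lambda>x. h (f x)) A"
  by (induction A rule: infinite_finite_induct) (auto simp: Pi_def)

end

section \<open>The tensor product as a quotient of the ring of formal sums\<close>

locale tensor = R: cring R + B: cring B
  for R :: "('r, 'm) ring_scheme" and B :: "('b, 'n) ring_scheme"
begin

abbreviation F where "F \<equiv> free_pair_ring R B"
abbreviation J where "J \<equiv> tensor_kernel R B"
abbreviation T where "T \<equiv> tensor_ring R B"
abbreviation gens where "gens \<equiv> carrier R \<times> carrier B"
abbreviation pure where "pure \<equiv> pure_tensor R B"

lemma carrier_F: "u \<in> carrier F \<longleftrightarrow> Poly_Mapping.keys u \<subseteq> gens"
  by (simp add: free_pair_ring_def)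

lemma F_ops [simp]: "u \<oplus>\<^bsub>F\<^esub> v = u + v" "\<zero>\<^bsub>F\<^esub> = 0" "\<one>\<^bsub>F\<^esub> = frag_of (\<one>\<^bsub>R\<^esub>, \<one>\<^bsub>B\<^esub>)"
  by (simp_all add: free_pair_ring_def)

lemma F_zero_closed: "0 \<in> carrier F"
  by (simp add: carrier_F)

lemma F_gen_closed: "r \<in> carrier R \<Longrightarrow> a \<in> carrier B \<Longrightarrow> frag_of (r, a) \<in> carrier F"
  by (simp add: carrier_F)

lemma F_add_closed: "u \<in> carrier F \<Longrightarrow> v \<in> carrier F \<Longrightarrow> u + v \<in> carrier F"
  using keys_add[of u v] by (auto simp: carrier_F)

lemma F_diff_closed: "u \<in> carrier F \<Longrightarrow> v \<in> carrier F \<Longrightarrow> u - v \<in> carrier F"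
  using keys_diff[of u v] by (auto simp: carrier_F)

text \<open>Differences of generators exhaust the free abelian group, so a law that is additive in
  each variable has to be checked on generators only.\<close>

lemma F_induct [consumes 1, case_names zero gen diff]:
  assumes "u \<in> carrier F" "P 0" "\<And>r a. r \<in> carrier R \<Longrightarrow> a \<in> carrier B \<Longrightarrow> P (frag_of (r, a))"
    "\<And>u v. u \<in> carrier F \<Longrightarrow> v \<in> carrier F \<Longrightarrow> P u \<Longrightarrow> P v \<Longrightarrow> P (u - v)"
  shows "P u"
  using assms(1) unfolding carrier_F
  by (rule free_Abelian_group_induct) (use assms(2-) in \<open>auto simp: carrier_F\<close>)

lemma F_mult_zero_left: "0 \<otimes>\<^bsub>F\<^esub> v = 0"
  and F_mult_diff_left: "(u - u') \<otimes>\<^bsub>F\<^esub> v = u \<otimes>\<^bsub>F\<^esub> v - u' \<otimes>\<^bsub>F\<^esub> v"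
  and F_mult_add_left: "(u + u') \<otimes>\<^bsub>F\<^esub> v = u \<otimes>\<^bsub>F\<^esub> v + u' \<otimes>\<^bsub>F\<^esub> v"
  and F_mult_gen: "frag_of (r, a) \<otimes>\<^bsub>F\<^esub> frag_of (s, b) = frag_of (r \<otimes>\<^bsub>R\<^esub> s, a \<otimes>\<^bsub>B\<^esub> b)"
  by (simp_all add: free_pair_ring_def frag_extend_diff frag_extend_add)

text \<open>The product extends the left factor first and keeps the right factor inside, so
  additivity on the right is not immediate. When the left factor is a generator, the outer extension
  disappears and the inner one is additive.\<close>

lemma F_mult_diff_right: "u \<in> carrier F \<Longrightarrow> u \<otimes>\<^bsub>F\<^esub> (v - v') = u \<otimes>\<^bsub>F\<^esub> v - u \<otimes>\<^bsub>F\<^esub> v'"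
proof (induction u rule: F_induct)
  case (gen r a)
  then show ?case by (simp add: free_pair_ring_def frag_extend_diff)
qed (simp_all add: F_mult_zero_left F_mult_diff_left)

lemma F_mult_zero_right: "u \<in> carrier F \<Longrightarrow> u \<otimes>\<^bsub>F\<^esub> 0 = 0"
  using F_mult_diff_right[of u 0 0] by simp

lemma F_mult_closed: "u \<in> carrier F \<Longrightarrow> v \<in> carrier F \<Longrightarrow> u \<otimes>\<^bsub>F\<^esub> v \<in> carrier F"
proof (induction u rule: F_induct)
  case (gen r a)
  show ?case using gen(3)
    by (induction v rule: F_induct)
      (use gen in \<open>simp_all add: F_mult_gen F_mult_zero_right F_mult_diff_right F_gen_closed F_zero_closed F_diff_closed\<close>)
qed (simp_all add: F_mult_zero_left F_mult_diff_left F_zero_closed F_diff_closed)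

lemma F_mult_comm: "u \<in> carrier F \<Longrightarrow> v \<in> carrier F \<Longrightarrow> u \<otimes>\<^bsub>F\<^esub> v = v \<otimes>\<^bsub>F\<^esub> u"
proof (induction u rule: F_induct)
  case (gen r a)
  show ?case using gen(3)
    by (induction v rule: F_induct)
      (use gen in \<open>simp_all add: F_mult_gen F_mult_zero_left F_mult_zero_right F_mult_diff_left F_mult_diff_right
         F_gen_closed R.m_comm B.m_comm\<close>)
qed (simp_all add: F_mult_zero_left F_mult_zero_right F_mult_diff_left F_mult_diff_right)

lemma F_mult_assoc:
  assumes "u \<in> carrier F" "v \<in> carrier F" "w \<in> carrier F"
  shows "u \<otimes>\<^bsub>F\<^esub> v \<otimes>\<^bsub>F\<^esub> w = u \<otimes>\<^bsub>F\<^esub> (v \<otimes>\<^bsub>F\<^esub> w)"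
  using assms(1)
proof (induction u rule: F_induct)
  case u: (gen r a)
  show ?case using assms(2)
  proof (induction v rule: F_induct)
    case v: (gen s b)
    show ?case using assms(3)
      by (induction w rule: F_induct)
        (use u v in \<open>simp_all add: F_mult_gen F_mult_zero_right F_mult_diff_right
           F_gen_closed R.m_assoc B.m_assoc\<close>)
  qed (use u in \<open>simp_all add: F_mult_zero_left F_mult_zero_right F_mult_diff_left F_mult_diff_right F_gen_closed\<close>)
qed (simp_all add: F_mult_zero_left F_mult_diff_left)

lemma F_mult_one: "u \<in> carrier F \<Longrightarrow> \<one>\<^bsub>F\<^esub> \<otimes>\<^bsub>F\<^esub> u = u"
  by (induction u rule: F_induct)
    (simp_all add: F_mult_gen F_mult_zero_right F_mult_diff_right F_gen_closed)

lemma cring_F: "cring F"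
proof (rule cringI)
  show "abelian_group F"
    by (rule abelian_groupI)
      (auto simp: F_add_closed F_zero_closed add_ac
        intro!: bexI[of _ "- x" for x] F_diff_closed[of 0, simplified])
  show "comm_monoid F"
    by (rule comm_monoidI)
      (auto simp: F_mult_closed F_gen_closed F_mult_assoc F_mult_one[simplified] intro: F_mult_comm)
qed (simp add: F_mult_add_left)

sublocale F: cring F
  by (rule cring_F)

lemma F_a_inv [simp]: "u \<in> carrier F \<Longrightarrow> \<ominus>\<^bsub>F\<^esub> u = - u"
  by (rule F.sum_zero_eq_neg[symmetric]) (use F_diff_closed[of 0 u] in \<open>auto simp: F_zero_closed\<close>)

lemma tensor_relations_subset: "tensor_relations R B \<subseteq> carrier F"
  by (auto simp: tensor_relations_def intro!: F_diff_closed F_gen_closed)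

lemma J_subgroup: "subgroup J (add_monoid F)"
  unfolding tensor_kernel_def
  by (rule group.generate_is_subgroup) (use tensor_relations_subset F.a_group in auto)

lemma J_closed: "u \<in> J \<Longrightarrow> u \<in> carrier F"
  using subgroup.subset[OF J_subgroup] by auto

lemma J_zero: "0 \<in> J"
  using subgroup.one_closed[OF J_subgroup] by simp

lemma J_add: "u \<in> J \<Longrightarrow> v \<in> J \<Longrightarrow> u + v \<in> J"
  using subgroup.m_closed[OF J_subgroup] by simp

lemma J_uminus: "u \<in> J \<Longrightarrow> - u \<in> J"
  using subgroup.m_inv_closed[OF J_subgroup, of u] F_a_inv[OF J_closed[of u]]
  by (simp only: a_inv_def)

lemma J_rel: "u \<in> tensor_relations R B \<Longrightarrow> u \<in> J"
  unfolding tensor_kernel_def by (rule generate.incl)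

text \<open>The induction rule of \<open>generate\<close>, with group inverses of relations
  rewritten as negatives in the type of formal sums.\<close>

lemma J_induct [consumes 1, case_names zero rel uminus add]:
  assumes "u \<in> J" "P 0" "\<And>u. u \<in> tensor_relations R B \<Longrightarrow> P u"
    "\<And>u. u \<in> J \<Longrightarrow> P u \<Longrightarrow> P (- u)" "\<And>u v. u \<in> J \<Longrightarrow> v \<in> J \<Longrightarrow> P u \<Longrightarrow> P v \<Longrightarrow> P (u + v)"
  shows "P u"
  using assms(1) unfolding tensor_kernel_def
proof (induction rule: generate.induct)
  case (inv h)
  then have "inv\<^bsub>add_monoid F\<^esub> h = - h"
    using tensor_relations_subset F_a_inv[of h] by (auto simp: a_inv_def)
  then show ?case using inv assms(3,4) J_rel by simp
qed (use assms(2-) in \<open>auto simp: tensor_kernel_def\<close>)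

text \<open>By distributivity in \<open>R\<close> or in \<open>B\<close>, multiplying both slots of
  a biadditivity relation by fixed elements gives a biadditivity relation of the same kind. This is
  what makes the generated subgroup an ideal.\<close>

lemma J_mult_gen:
  assumes "u \<in> tensor_relations R B" "s \<in> carrier R" "b \<in> carrier B"
  shows "u \<otimes>\<^bsub>F\<^esub> frag_of (s, b) \<in> J"
proof (rule J_rel)
  have "u \<otimes>\<^bsub>F\<^esub> frag_of (s, b) \<in>
     {frag_of (r \<oplus>\<^bsub>R\<^esub> r', a) - frag_of (r, a) - frag_of (r', a) | r r' a.
        r \<in> carrier R \<and> r' \<in> carrier R \<and> a \<in> carrier B}"
    if "u = frag_of (r \<oplus>\<^bsub>R\<^esub> r', a) - frag_of (r, a) - frag_of (r', a)"
      "r \<in> carrier R" "r' \<in> carrier R" "a \<in> carrier B" for r r' a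
    using that assms
    by (intro CollectI exI[of _ "r \<otimes>\<^bsub>R\<^esub> s"] exI[of _ "r' \<otimes>\<^bsub>R\<^esub> s"] exI[of _ "a \<otimes>\<^bsub>B\<^esub> b"])
      (simp add: F_mult_diff_left F_mult_gen R.l_distr)
  moreover have "u \<otimes>\<^bsub>F\<^esub> frag_of (s, b) \<in>
     {frag_of (r, a \<oplus>\<^bsub>B\<^esub> a') - frag_of (r, a) - frag_of (r, a') | r a a'.
        r \<in> carrier R \<and> a \<in> carrier B \<and> a' \<in> carrier B}"
    if "u = frag_of (r, a \<oplus>\<^bsub>B\<^esub> a') - frag_of (r, a) - frag_of (r, a')"
      "r \<in> carrier R" "a \<in> carrier B" "a' \<in> carrier B" for r a a'
    using that assms
    by (intro CollectI exI[of _ "r \<otimes>\<^bsub>R\<^esub> s"] exI[of _ "a \<otimes>\<^bsub>B\<^esub> b"] exI[of _ "a' \<otimes>\<^bsub>B\<^esub> b"])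
      (simp add: F_mult_diff_left F_mult_gen B.l_distr)
  ultimately show "u \<otimes>\<^bsub>F\<^esub> frag_of (s, b) \<in> tensor_relations R B"
    using assms(1) unfolding tensor_relations_def by blast
qed

lemma J_mult:
  assumes "u \<in> J" "v \<in> carrier F"
  shows "u \<otimes>\<^bsub>F\<^esub> v \<in> J"
  using assms(2)
proof (induction v rule: F_induct)
  case (gen s b)
  from assms(1) show ?case
  proof (induction u rule: J_induct)
    case (uminus u)
    then show ?case
      using F_mult_diff_left[of 0 u] J_uminus by (simp add: F_mult_zero_left)
  qed (use gen in \<open>simp_all add: F_mult_zero_left F_mult_add_left J_zero J_add J_mult_gen\<close>)
next
  case (diff v w)
  then show ?case
    using J_add[OF _ J_uminus] assms(1) by (fastforce simp: F_mult_diff_right J_closed)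
qed (simp add: F_mult_zero_right J_closed J_zero assms)

lemma ideal_J: "ideal J F"
  by (rule idealI) (use F.ring_axioms J_subgroup J_mult in \<open>auto simp: F_mult_comm J_closed\<close>)

sublocale J: ideal J F
  by (rule ideal_J)

sublocale T: cring T
  unfolding tensor_ring_def by (rule J.quotient_is_cring[OF F.is_cring])

sublocale q: ring_hom_ring F T "\<lambda>u. J +>\<^bsub>F\<^esub> u"
  unfolding tensor_ring_def by (rule J.rcos_ring_hom_ring)

lemma T_carrierE:
  assumes "x \<in> carrier T"
  obtains u where "u \<in> carrier F" "x = J +>\<^bsub>F\<^esub> u"
  using assms by (auto simp: tensor_ring_def FactRing_def A_RCOSETS_def' a_r_coset_def')

lemma q_J: "u \<in> J \<Longrightarrow> J +>\<^bsub>F\<^esub> u = \<zero>\<^bsub>T\<^esub>"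
  by (simp add: J.a_rcos_const tensor_ring_def FactRing_def)

lemma q_minus:
  assumes "u \<in> carrier F" "v \<in> carrier F"
  shows "J +>\<^bsub>F\<^esub> (u - v) = (J +>\<^bsub>F\<^esub> u) \<ominus>\<^bsub>T\<^esub> (J +>\<^bsub>F\<^esub> v)"
  using q.hom_add[of u "\<ominus>\<^bsub>F\<^esub> v"] assms by (simp add: a_minus_def del: F_a_inv) simp

lemma pure_eq: "pure r a = J +>\<^bsub>F\<^esub> frag_of (r, a)"
  by (simp add: pure_tensor_def)

lemma pure_closed: "r \<in> carrier R \<Longrightarrow> a \<in> carrier B \<Longrightarrow> pure r a \<in> carrier T"
  by (simp add: pure_eq F_gen_closed)

lemma pure_add_left:
  assumes "r \<in> carrier R" "r' \<in> carrier R" "a \<in> carrier B"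
  shows "pure (r \<oplus>\<^bsub>R\<^esub> r') a = pure r a \<oplus>\<^bsub>T\<^esub> pure r' a"
proof -
  let ?k = "frag_of (r \<oplus>\<^bsub>R\<^esub> r', a) - frag_of (r, a) - frag_of (r', a)"
  have k: "?k \<in> J" using assms by (intro J_rel) (auto simp: tensor_relations_def)
  have "frag_of (r \<oplus>\<^bsub>R\<^esub> r', a) = ?k \<oplus>\<^bsub>F\<^esub> (frag_of (r, a) \<oplus>\<^bsub>F\<^esub> frag_of (r', a))" by simp
  then have "pure (r \<oplus>\<^bsub>R\<^esub> r') a = (J +>\<^bsub>F\<^esub> ?k) \<oplus>\<^bsub>T\<^esub> (pure r a \<oplus>\<^bsub>T\<^esub> pure r' a)"
    unfolding pure_eq using assms J_closed[OF k] F_gen_closed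
    by (metis q.hom_add F.a_closed)
  then show ?thesis using q_J[OF k] assms by (simp add: pure_closed)
qed

lemma pure_add_right:
  assumes "r \<in> carrier R" "a \<in> carrier B" "a' \<in> carrier B"
  shows "pure r (a \<oplus>\<^bsub>B\<^esub> a') = pure r a \<oplus>\<^bsub>T\<^esub> pure r a'"
proof -
  let ?k = "frag_of (r, a \<oplus>\<^bsub>B\<^esub> a') - frag_of (r, a) - frag_of (r, a')"
  have k: "?k \<in> J" using assms by (intro J_rel) (auto simp: tensor_relations_def)
  have "frag_of (r, a \<oplus>\<^bsub>B\<^esub> a') = ?k \<oplus>\<^bsub>F\<^esub> (frag_of (r, a) \<oplus>\<^bsub>F\<^esub> frag_of (r, a'))" by simp
  then have "pure r (a \<oplus>\<^bsub>B\<^esub> a') = (J +>\<^bsub>F\<^esub> ?k) \<oplus>\<^bsub>T\<^esub> (pure r a \<oplus>\<^bsub>T\<^esub> pure r a')"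
    unfolding pure_eq using assms J_closed[OF k] F_gen_closed
    by (metis q.hom_add F.a_closed)
  then show ?thesis using q_J[OF k] assms by (simp add: pure_closed)
qed

lemma pure_mult:
  assumes "r \<in> carrier R" "a \<in> carrier B" "s \<in> carrier R" "b \<in> carrier B"
  shows "pure r a \<otimes>\<^bsub>T\<^esub> pure s b = pure (r \<otimes>\<^bsub>R\<^esub> s) (a \<otimes>\<^bsub>B\<^esub> b)"
  using assms q.hom_mult[of "frag_of (r, a)" "frag_of (s, b)"]
  by (simp add: pure_eq F_gen_closed F_mult_gen)

lemma pure_hom_left: "a \<in> carrier B \<Longrightarrow> abelian_group_hom R T (\<lambda>r. pure r a)"
  by (rule abelian_group_hom_addI)
    (use R.abelian_group_axioms T.abelian_group_axioms in \<open>auto simp: pure_closed pure_add_left\<close>)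

lemma pure_hom_right: "r \<in> carrier R \<Longrightarrow> abelian_group_hom B T (pure r)"
  by (rule abelian_group_hom_addI)
    (use B.abelian_group_axioms T.abelian_group_axioms in \<open>auto simp: pure_closed pure_add_right\<close>)

lemma tensor_induct [consumes 1, case_names zero pure minus]:
  assumes "x \<in> carrier T" "P \<zero>\<^bsub>T\<^esub>" "\<And>r a. r \<in> carrier R \<Longrightarrow> a \<in> carrier B \<Longrightarrow> P (pure r a)"
    "\<And>x y. x \<in> carrier T \<Longrightarrow> y \<in> carrier T \<Longrightarrow> P x \<Longrightarrow> P y \<Longrightarrow> P (x \<ominus>\<^bsub>T\<^esub> y)"
  shows "P x"
proof -
  obtain u where "u \<in> carrier F" and x: "x = J +>\<^bsub>F\<^esub> u"
    using assms(1) by (rule T_carrierE)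
  from this(1) have "P (J +>\<^bsub>F\<^esub> u)"
  proof (induction u rule: F_induct)
    case zero
    then show ?case using assms(2) by (simp add: q_J J_zero)
  next
    case (gen r a)
    then show ?case using assms(3) by (simp add: pure_eq)
  next
    case (diff u v)
    then show ?case using assms(4) by (simp add: q_minus)
  qed
  then show ?thesis by (simp add: x)
qed

text \<open>The map that sends \<open>(r, a)\<close> to the multiple \<open>C a\<close> of
  \<open>r\<close> is biadditive, so it factors through the tensor product. When \<open>C\<close> is
  an integer coordinate on \<open>B\<close>, the lift \<open>H\<close> is the corresponding
  coordinate with values in \<open>R\<close>.\<close>

lemma ex_tensor_lift:
  fixes C :: "'b \<Rightarrow> int"
  assumes C: "\<And>a b. a \<in> carrier B \<Longrightarrow> b \<in> carrier B \<Longrightarrow> C (a \<oplus>\<^bsub>B\<^esub> b) = C a + C b"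
  obtains H where "abelian_group_hom T R H"
    "\<And>r a. r \<in> carrier R \<Longrightarrow> a \<in> carrier B \<Longrightarrow> H (pure r a) = [C a] \<cdot>\<^bsub>R\<^esub> r"
proof -
  obtain h where h: "h \<in> hom (free_Abelian_group gens) (add_monoid R)"
    and h_gen: "\<And>p. p \<in> gens \<Longrightarrow> h (frag_of p) = (\<lambda>(r, a). [C a] \<cdot>\<^bsub>R\<^esub> r) p"
    by (rule comm_group.free_Abelian_group_universal
        [OF R.a_comm_group, of "\<lambda>(r, a). [C a] \<cdot>\<^bsub>R\<^esub> r" gens]) auto
  interpret h: abelian_group_hom F R h
  proof (rule abelian_group_hom_addI)
    show "h x \<in> carrier R" if "x \<in> carrier F" for x
      using h that unfolding hom_def carrier_F by auto
    show "h (x \<oplus>\<^bsub>F\<^esub> y) = h x \<oplus>\<^bsub>R\<^esub> h y" if "x \<in> carrier F" "y \<in> carrier F" for x y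
      using h that unfolding hom_def carrier_F by auto
  qed (use F.abelian_group_axioms R.abelian_group_axioms in auto)
  have h_diff: "h (u - v) = h u \<ominus>\<^bsub>R\<^esub> h v" if "u \<in> carrier F" "v \<in> carrier F" for u v
    using h.hom_minus[OF that] that by (simp add: a_minus_def)
  have h_J: "h u = \<zero>\<^bsub>R\<^esub>" if "u \<in> J" for u
    using that
  proof (induction u rule: J_induct)
    case zero
    then show ?case using h.hom_zero by simp
  next
    case (rel u)
    \<comment> \<open>Both kinds of relations reduce to this cancellation: \<open>y\<close> and
      \<open>z\<close> are the \<open>C a\<close>-fold multiples of \<open>r\<close> and
      \<open>r'\<close> for the first kind, the \<open>C a\<close>-fold and \<open>C a'\<close>-fold
      multiples of \<open>r\<close> for the second.\<close>
    have "y \<oplus>\<^bsub>R\<^esub> z \<ominus>\<^bsub>R\<^esub> y \<ominus>\<^bsub>R\<^esub> z = \<zero>\<^bsub>R\<^esub>" if "y \<in> carrier R" "z \<in> carrier R" for y z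
    proof -
      have "y \<oplus>\<^bsub>R\<^esub> z \<ominus>\<^bsub>R\<^esub> y \<ominus>\<^bsub>R\<^esub> z = (y \<oplus>\<^bsub>R\<^esub> z) \<oplus>\<^bsub>R\<^esub> \<ominus>\<^bsub>R\<^esub> (y \<oplus>\<^bsub>R\<^esub> z)"
        using that by (simp add: a_minus_def R.minus_add R.a_assoc)
      then show ?thesis using that by (simp add: R.r_neg)
    qed
    with rel show ?case
      by (auto simp: tensor_relations_def h_diff F_gen_closed F_diff_closed h_gen
          R.add.int_pow_distrib R.add.int_pow_mult C)
  next
    case (uminus u)
    then show ?case using h.hom_a_inv[of u] J_closed by simp
  next
    case (add u v)
    then show ?case using h.hom_add[of u v] J_closed by simp
  qed
  \<comment> \<open>A coset is evaluated at an arbitrary representative. Two representatives differ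
    by an element of \<open>J\<close>, on which \<open>h\<close> vanishes.\<close>
  define H where "H x = h (SOME u. u \<in> x)" for x
  have H: "H (J +>\<^bsub>F\<^esub> u) = h u" if u: "u \<in> carrier F" for u
  proof -
    have "u \<in> J +>\<^bsub>F\<^esub> u" using u by (rule J.a_rcos_self)
    then have "(SOME v. v \<in> J +>\<^bsub>F\<^esub> u) \<in> J +>\<^bsub>F\<^esub> u" by (rule someI)
    then obtain k where k: "k \<in> J" "(SOME v. v \<in> J +>\<^bsub>F\<^esub> u) = k + u"
      by (auto simp: a_r_coset_def')
    then show ?thesis
      using h.hom_add[of k u] u J_closed[of k] h_J[of k] by (simp add: H_def)
  qed
  have "abelian_group_hom T R H"
  proof (rule abelian_group_hom_addI)
    fix x y assume "x \<in> carrier T" "y \<in> carrier T"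
    then obtain u v where uv: "u \<in> carrier F" "x = J +>\<^bsub>F\<^esub> u" "v \<in> carrier F" "y = J +>\<^bsub>F\<^esub> v"
      by (elim T_carrierE)
    then show "H (x \<oplus>\<^bsub>T\<^esub> y) = H x \<oplus>\<^bsub>R\<^esub> H y"
      using q.hom_add[of u v] h.hom_add[of u v] H[OF F_add_closed[OF uv(1,3)]] by (simp add: H)
  next
    fix x assume "x \<in> carrier T"
    then show "H x \<in> carrier R" by (elim T_carrierE) (simp add: H)
  qed (use T.abelian_group_axioms R.abelian_group_axioms in auto)
  moreover have "H (pure r a) = [C a] \<cdot>\<^bsub>R\<^esub> r" if "r \<in> carrier R" "a \<in> carrier B" for r a
    using that by (simp add: pure_eq H F_gen_closed h_gen)
  ultimately show ?thesis by (rule that)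
qed

text \<open>The coordinates \<open>C t\<close> lift to maps \<open>H t\<close>, and every
  \<open>x\<close> is the sum of the tensors \<open>pure (H t x) (a t)\<close>. If \<open>n\<close>
  kills \<open>x\<close>, it kills each \<open>H t x\<close> in \<open>R\<close>, so all summands
  vanish.\<close>

lemma tensor_torsion_free:
  fixes C :: "'t \<Rightarrow> 'b \<Rightarrow> int"
  assumes a: "\<And>t. t \<in> I \<Longrightarrow> a t \<in> carrier B"
    and C_add: "\<And>t b c. t \<in> I \<Longrightarrow> b \<in> carrier B \<Longrightarrow> c \<in> carrier B \<Longrightarrow> C t (b \<oplus>\<^bsub>B\<^esub> c) = C t b + C t c"
    and gen: "\<And>b. b \<in> carrier B \<Longrightarrow> b = (\<Oplus>\<^bsub>B\<^esub>t\<in>I. [C t b] \<cdot>\<^bsub>B\<^esub> a t)"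
    and tf: "\<And>r. r \<in> carrier R \<Longrightarrow> [(n :: nat)] \<cdot>\<^bsub>R\<^esub> r = \<zero>\<^bsub>R\<^esub> \<Longrightarrow> r = \<zero>\<^bsub>R\<^esub>"
    and x: "x \<in> carrier T" and nx: "[n] \<cdot>\<^bsub>T\<^esub> x = \<zero>\<^bsub>T\<^esub>"
  shows "x = \<zero>\<^bsub>T\<^esub>"
proof -
  have "\<exists>H. abelian_group_hom T R H \<and>
      (\<forall>r\<in>carrier R. \<forall>b\<in>carrier B. H (pure r b) = [C t b] \<cdot>\<^bsub>R\<^esub> r)" if "t \<in> I" for t
    using C_add[OF that] by (rule ex_tensor_lift[where C = "C t"]) auto
  then obtain H where H: "\<And>t. t \<in> I \<Longrightarrow> abelian_group_hom T R (H t)"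
    and H_pure: "\<And>t r b. t \<in> I \<Longrightarrow> r \<in> carrier R \<Longrightarrow> b \<in> carrier B \<Longrightarrow> H t (pure r b) = [C t b] \<cdot>\<^bsub>R\<^esub> r"
    by metis
  have H_closed: "H t y \<in> carrier R" if "t \<in> I" "y \<in> carrier T" for t y
    using abelian_group_hom.hom_closed[OF H] that .
  have sum_closed: "(\<lambda>t. pure (H t y) (a t)) \<in> I \<rightarrow> carrier T" if "y \<in> carrier T" for y
    using that by (auto simp: H_closed a pure_closed)
  \<comment> \<open>The recovery map is shown to be additive first, so that it has to be compared
    with the identity on pure tensors only.\<close>
  interpret E: abelian_group_hom T T "\<lambda>y. \<Oplus>\<^bsub>T\<^esub>t\<in>I. pure (H t y) (a t)"
  proof (rule abelian_group_hom_addI)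
    fix y z assume yz: "y \<in> carrier T" "z \<in> carrier T"
    have "(\<Oplus>\<^bsub>T\<^esub>t\<in>I. pure (H t (y \<oplus>\<^bsub>T\<^esub> z)) (a t))
        = (\<Oplus>\<^bsub>T\<^esub>t\<in>I. pure (H t y) (a t) \<oplus>\<^bsub>T\<^esub> pure (H t z) (a t))"
      by (rule T.finsum_cong') (use yz in \<open>auto simp: abelian_group_hom.hom_add[OF H] H_closed a pure_closed pure_add_left\<close>)
    also have "\<dots> = (\<Oplus>\<^bsub>T\<^esub>t\<in>I. pure (H t y) (a t)) \<oplus>\<^bsub>T\<^esub> (\<Oplus>\<^bsub>T\<^esub>t\<in>I. pure (H t z) (a t))"
      using yz by (intro T.finsum_addf sum_closed)
    finally show "(\<Oplus>\<^bsub>T\<^esub>t\<in>I. pure (H t (y \<oplus>\<^bsub>T\<^esub> z)) (a t)) = \<dots>" .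
  qed (use T.abelian_group_axioms sum_closed in \<open>auto intro!: T.finsum_closed\<close>)
  have "x = (\<Oplus>\<^bsub>T\<^esub>t\<in>I. pure (H t x) (a t))"
    using x
  proof (induction x rule: tensor_induct)
    case zero
    then show ?case by (simp only: E.hom_zero)
  next
    case (pure r b)
    have "pure r b = pure r (\<Oplus>\<^bsub>B\<^esub>t\<in>I. [C t b] \<cdot>\<^bsub>B\<^esub> a t)"
      using gen[OF pure(2)] by simp
    also have "\<dots> = (\<Oplus>\<^bsub>T\<^esub>t\<in>I. pure r ([C t b] \<cdot>\<^bsub>B\<^esub> a t))"
      using a by (intro abelian_group_hom.hom_finsum[OF pure_hom_right[OF pure(1)]]) auto
    \<comment> \<open>The integer \<open>C t b\<close> crosses from the right slot to the left one:
      by additivity in each slot, both terms are the \<open>C t b\<close>-fold multiple of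
      \<open>pure r (a t)\<close>.\<close>
    also have "\<dots> = (\<Oplus>\<^bsub>T\<^esub>t\<in>I. pure (H t (pure r b)) (a t))"
    proof (rule T.finsum_cong')
      fix t assume t: "t \<in> I"
      then show "pure r ([C t b] \<cdot>\<^bsub>B\<^esub> a t) = pure (H t (pure r b)) (a t)"
        using pure a H_pure[OF t] abelian_group_hom.hom_add_pow_int[OF pure_hom_right[OF pure(1)], of "a t"]
          abelian_group_hom.hom_add_pow_int[OF pure_hom_left[OF a[OF t]], of r] by simp
    qed (use pure sum_closed pure_closed in auto)
    finally show ?case .
  next
    case (minus x y)
    then show ?case by (simp only: E.hom_minus)
  qed
  also have "\<dots> = (\<Oplus>\<^bsub>T\<^esub>t\<in>I. \<zero>\<^bsub>T\<^esub>)"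
  proof (rule T.finsum_cong')
    fix t assume t: "t \<in> I"
    have "[n] \<cdot>\<^bsub>R\<^esub> H t x = \<zero>\<^bsub>R\<^esub>"
      using abelian_group_hom.hom_add_pow_nat[OF H[OF t] x, of n] nx abelian_group_hom.hom_zero[OF H[OF t]] by simp
    then have "H t x = \<zero>\<^bsub>R\<^esub>" using tf t x H_closed by blast
    then show "pure (H t x) (a t) = \<zero>\<^bsub>T\<^esub>"
      using abelian_group_hom.hom_zero[OF pure_hom_left[OF a[OF t]]] by simp
  qed auto
  finally show ?thesis by simp
qed

end


section \<open>Orbits\<close>

definition gset_sub :: "('g, 'x) gset \<Rightarrow> 'x set \<Rightarrow> ('g, 'x) gset" where
  "gset_sub U E = (E, \<lambda>g. \<lambda>x\<in>E. snd U g x)"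

context group
begin

definition invariant :: "('a, 'x) gset \<Rightarrow> 'x set \<Rightarrow> bool" where
  "invariant U E \<longleftrightarrow> E \<subseteq> fst U \<and> (\<forall>g\<in>carrier G. \<forall>x\<in>E. snd U g x \<in> E)"

abbreviation orb :: "('a, 'x) gset \<Rightarrow> 'x \<Rightarrow> 'x set" where
  "orb U \<equiv> orbit G (snd U)"

abbreviation stab :: "('a, 'x) gset \<Rightarrow> 'x \<Rightarrow> 'a set" where
  "stab U \<equiv> stabilizer G (snd U)"

text \<open>Taking the class, rather than the orbit itself, makes orbits in G-sets of different
  types comparable.\<close>

definition orbit_type :: "('a, 'x) gset \<Rightarrow> 'x \<Rightarrow> 'a gset_iso_class" where
  "orbit_type U x = gset_class G (gset_sub U (orb U x))"

lemma fst_gset_sub [simp]: "fst (gset_sub U E) = E"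
  by (simp add: gset_sub_def)

lemma snd_gset_sub: "x \<in> E \<Longrightarrow> snd (gset_sub U E) g x = snd U g x"
  by (simp add: gset_sub_def)

lemma invariantD:
  assumes "invariant U E"
  shows "E \<subseteq> fst U" "g \<in> carrier G \<Longrightarrow> x \<in> E \<Longrightarrow> snd U g x \<in> E"
  using assms by (auto simp: invariant_def)

lemma finite_gset_sub:
  assumes U: "finite_gset G U" and E: "invariant U E"
  shows "finite_gset G (gset_sub U E)"
  unfolding gset_sub_def
proof (rule finite_gsetI)
  show "finite E" using finite_gset_finite[OF U] invariantD(1)[OF E] by (rule finite_subset[rotated])
qed (use invariantD[OF E] in \<open>auto simp: is_group gset_one[OF U] gset_mult[OF U] subset_iff\<close>)

lemma orbit_stabilizer:
  assumes "finite_gset G U" "x \<in> fst U"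
  shows "card (orb U x) * card (stab U x) = order G"
  using assms group_action.orbit_stabilizer_theorem[of G "fst U" "snd U" x] by (simp add: finite_gset_def)

lemma orb_self: "finite_gset G U \<Longrightarrow> x \<in> fst U \<Longrightarrow> x \<in> orb U x"
  using group_action.orbit_refl[of G "fst U" "snd U" x] by (simp add: finite_gset_def)

lemma orb_subset: "finite_gset G U \<Longrightarrow> x \<in> fst U \<Longrightarrow> orb U x \<subseteq> fst U"
  by (auto simp: orbit_def gset_closed)

lemma orb_invariant:
  assumes "finite_gset G U" "x \<in> fst U"
  shows "invariant U (orb U x)"
  unfolding invariant_def
proof (intro conjI ballI)
  fix g y assume g: "g \<in> carrier G" and "y \<in> orb U x"
  then obtain h where h: "h \<in> carrier G" "y = snd U h x" by (auto simp: orbit_def)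
  then have "snd U g y = snd U (g \<otimes> h) x" using assms g by (simp add: gset_mult)
  then show "snd U g y \<in> orb U x" using g h by (auto simp: orbit_def)
qed (rule orb_subset[OF assms])

lemma orb_minimal: "invariant U E \<Longrightarrow> x \<in> E \<Longrightarrow> orb U x \<subseteq> E"
  by (auto simp: orbit_def invariant_def)

lemma orb_eq:
  assumes "finite_gset G U" "x \<in> fst U" "y \<in> orb U x"
  shows "orb U y = orb U x"
proof
  have y: "y \<in> fst U" using orb_subset[OF assms(1,2)] assms(3) by blast
  show "orb U y \<subseteq> orb U x" by (rule orb_minimal[OF orb_invariant[OF assms(1,2)] assms(3)])
  have "x \<in> orb U y"
    using group_action.orbit_sym[of G "fst U" "snd U" x y] assms y by (simp add: finite_gset_def)
  then show "orb U x \<subseteq> orb U y" by (rule orb_minimal[OF orb_invariant[OF assms(1) y]])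
qed

lemma invariant_Un: "invariant U E \<Longrightarrow> invariant U E' \<Longrightarrow> invariant U (E \<union> E')"
  by (auto simp: invariant_def)

lemma invariant_Diff:
  assumes U: "finite_gset G U" and E: "invariant U E" "invariant U E'"
  shows "invariant U (E - E')"
  unfolding invariant_def
proof (intro conjI ballI)
  fix g x assume g: "g \<in> carrier G" and x: "x \<in> E - E'"
  then have "x \<in> fst U" using invariantD(1)[OF E(1)] by blast
  then have "snd U g x \<in> E' \<Longrightarrow> x \<in> E'"
    using invariantD(2)[OF E(2), of "inv g" "snd U g x"] gset_inv_left[OF U g] g by simp
  then show "snd U g x \<in> E - E'" using x g invariantD(2)[OF E(1)] by blast
qed (use invariantD(1)[OF E(1)] in blast)

text \<open>Removing the orbit of a point from a nonempty invariant set leaves a smaller invariant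
  set. The predicate speaks of subsets of \<open>U\<close>, so the ambient action stays fixed while
  orbits are added.\<close>

lemma gset_induct [consumes 1, case_names empty orbit]:
  assumes U: "finite_gset G U" and "P {}"
    and step: "\<And>E x. invariant U E \<Longrightarrow> x \<in> fst U \<Longrightarrow> x \<notin> E \<Longrightarrow> orb U x \<inter> E = {} \<Longrightarrow> P E \<Longrightarrow> P (E \<union> orb U x)"
  shows "P (fst U)"
proof -
  have "P E" if "invariant U E" for E
    using that
  proof (induction "card E" arbitrary: E rule: less_induct)
    case less
    have fin: "finite E" using invariantD(1)[OF less(2)] finite_gset_finite[OF U] by (rule finite_subset)
    show ?case
    proof (cases "E = {}")
      case False
      then obtain x where x: "x \<in> E" by blast
      then have xU: "x \<in> fst U" using invariantD(1)[OF less(2)] by blast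
      let ?E = "E - orb U x"
      have inv: "invariant U ?E" by (intro invariant_Diff orb_invariant U less(2) xU)
      have "card ?E < card E"
        using orb_self[OF U xU] x fin by (intro psubset_card_mono) auto
      then have "P ?E" using less(1) inv by blast
      then have "P (?E \<union> orb U x)" using orb_self[OF U xU] xU inv by (intro step) auto
      moreover have "?E \<union> orb U x = E" using orb_minimal[OF less(2) x] by blast
      ultimately show ?thesis by simp
    qed (use assms(2) in simp)
  qed
  then show ?thesis using gset_closed[OF U] by (auto simp: invariant_def)
qed

lemma gset_class_sub_Un:
  assumes U: "finite_gset G U" and E: "invariant U E" "invariant U E'" and "E \<inter> E' = {}"
  shows "gset_class G (gset_sub U (E \<union> E')) = gset_class G (gset_sub U E) \<oplus>\<^bsub>gset_semiring G\<^esub> gset_class G (gset_sub U E')"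
  unfolding gset_class_add[OF finite_gset_sub[OF U E(1)] finite_gset_sub[OF U E(2)]]
proof (rule sym, rule gset_class_eqI)
  show "gset_iso G (gset_sum (gset_sub U E) (gset_sub U E')) (gset_sub U (E \<union> E'))"
  proof (rule gset_isoI)
    show "bij_betw (case_sum id id) (fst (gset_sum (gset_sub U E) (gset_sub U E'))) (fst (gset_sub U (E \<union> E')))"
      by (rule bij_betw_byWitness[where f' = "\<lambda>x. if x \<in> E then Inl x else Inr x"])
        (use assms(4) in \<open>auto simp: gset_sum_def gset_sub_def\<close>)
  qed (use invariantD[OF E(1)] invariantD[OF E(2)] in \<open>auto simp: gset_sum_def gset_sub_def\<close>)
qed (intro finite_gset_sum finite_gset_sub U E)

lemma gset_class_sub_whole:
  assumes "finite_gset G U"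
  shows "gset_class G (gset_sub U (fst U)) = gset_class G U"
  by (rule gset_class_eqI)
    (use assms in \<open>auto intro!: finite_gset_sub gset_isoI[of id] simp: invariant_def gset_closed snd_gset_sub\<close>)

lemma gset_class_sub_empty: "gset_class G (gset_sub U {}) = \<zero>\<^bsub>gset_semiring G\<^esub>"
  unfolding gset_class_zero
  by (rule gset_class_eqI)
    (auto simp: gset_sub_def gset_empty_def is_group bij_betw_def
      intro!: finite_gsetI[where E = "{}"] gset_isoI[of "\<lambda>_. ()"])

lemma orbit_type_closed:
  "finite_gset G U \<Longrightarrow> x \<in> fst U \<Longrightarrow> orbit_type U x \<in> carrier (gset_semiring G)"
  unfolding orbit_type_def by (intro gset_class_closed finite_gset_sub orb_invariant)

lemma orb_image:
  assumes "\<And>g. g \<in> carrier G \<Longrightarrow> f (snd U g x) = snd V g (f x)"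
  shows "orb V (f x) = f ` orb U x"
  using assms by (force simp: orbit_def)

text \<open>An equivariant map that is injective restricts to an isomorphism from each orbit onto
  its image. Surjectivity onto \<open>V\<close> is not assumed, so this covers isomorphisms, the
  inclusions of summands and the inclusions of invariant subsets alike.\<close>

lemma orbit_type_image:
  assumes U: "finite_gset G U" "x \<in> fst U"
    and f: "inj_on f (fst U)" "\<And>g y. g \<in> carrier G \<Longrightarrow> y \<in> fst U \<Longrightarrow> f (snd U g y) = snd V g (f y)"
  shows "orbit_type V (f x) = orbit_type U x"
  unfolding orbit_type_def
proof (rule sym, rule gset_class_eqI[OF finite_gset_sub[OF U(1) orb_invariant[OF U]]], rule gset_isoI)
  have orb: "orb V (f x) = f ` orb U x" using f(2) U(2) by (intro orb_image)
  show "bij_betw f (fst (gset_sub U (orb U x))) (fst (gset_sub V (orb V (f x))))"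
    unfolding bij_betw_def using orb inj_on_subset[OF f(1) orb_subset[OF U]] by simp
  fix g y assume gy: "g \<in> carrier G" "y \<in> fst (gset_sub U (orb U x))"
  then have "y \<in> orb U x" "y \<in> fst U" using orb_subset[OF U] by auto
  then show "f (snd (gset_sub U (orb U x)) g y) = snd (gset_sub V (orb V (f x))) g (f y)"
    using gy f(2) orb by (simp add: snd_gset_sub)
qed

lemma orb_sub: "x \<in> E \<Longrightarrow> orb (gset_sub U E) x = orb U x"
  by (auto simp: orbit_def snd_gset_sub)

lemma stab_sub: "x \<in> E \<Longrightarrow> stab (gset_sub U E) x = stab U x"
  by (auto simp: stabilizer_def snd_gset_sub)

lemma orbit_type_sub:
  assumes "finite_gset G U" "invariant U E" "x \<in> E"
  shows "orbit_type (gset_sub U E) x = orbit_type U x"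
  using orbit_type_image[of "gset_sub U E" x id U] finite_gset_sub[OF assms(1,2)] assms(3)
  by (simp add: snd_gset_sub)

section \<open>Stabilizers determine orbits\<close>

lemma gset_action_eq_iff:
  assumes "finite_gset G U" "x \<in> fst U" "g \<in> carrier G" "h \<in> carrier G"
  shows "snd U g x = snd U h x \<longleftrightarrow> inv h \<otimes> g \<in> stab U x"
proof -
  have "inv h \<otimes> g \<in> stab U x \<longleftrightarrow> snd U (inv h) (snd U g x) = x"
    using assms by (simp add: stabilizer_def gset_mult)
  also have "\<dots> \<longleftrightarrow> snd U g x = snd U h x"
    using assms gset_inv_left[OF assms(1,4,2)] gset_inv_right[OF assms(1,4)]
    by (metis gset_closed)
  finally show ?thesis ..
qed

text \<open>Both orbits are copies of the cosets of the common stabilizer. This bounds the number of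
  orbit types and later identifies orbits in a product.\<close>

lemma orbit_type_eq_of_stab:
  assumes U: "finite_gset G U" "x \<in> fst U" and V: "finite_gset G V" "y \<in> fst V"
    and eq: "stab U x = stab V y"
  shows "orbit_type U x = orbit_type V y"
proof -
  have iff: "snd U g x = snd U h x \<longleftrightarrow> snd V g y = snd V h y" if "g \<in> carrier G" "h \<in> carrier G" for g h
    using gset_action_eq_iff[OF U that] gset_action_eq_iff[OF V that] eq by simp
  \<comment> \<open>The point g x is sent to g y. Since \<open>g\<close> and \<open>h\<close> agree
    on \<open>x\<close> exactly when they agree on \<open>y\<close>, the chosen group element is
    immaterial and the map is injective.\<close>
  define f where "f z = snd V (SOME g. g \<in> carrier G \<and> snd U g x = z) y" for z
  have f: "f (snd U g x) = snd V g y" if "g \<in> carrier G" for g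
  proof -
    have "(SOME h. h \<in> carrier G \<and> snd U h x = snd U g x) \<in> carrier G \<and>
        snd U (SOME h. h \<in> carrier G \<and> snd U h x = snd U g x) x = snd U g x"
      by (rule someI[of _ g]) (use that in simp)
    then show ?thesis unfolding f_def using iff[OF _ that] by blast
  qed
  have inj: "inj_on f (orb U x)"
    using iff by (auto simp: inj_on_def orbit_def f)
  have x: "f x = y" using f[of \<one>] U V by (simp add: gset_one)
  have "orbit_type V (f x) = orbit_type (gset_sub U (orb U x)) x"
  proof (rule orbit_type_image)
    fix g z assume g: "g \<in> carrier G" and z: "z \<in> fst (gset_sub U (orb U x))"
    then obtain h where h: "h \<in> carrier G" "z = snd U h x" by (auto simp: orbit_def)
    then show "f (snd (gset_sub U (orb U x)) g z) = snd V g (f z)"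
      using z g U V by (simp add: snd_gset_sub f flip: gset_mult)
  qed (use inj U in \<open>auto intro: finite_gset_sub orb_invariant orb_self\<close>)
  then show ?thesis
    using x orbit_type_sub[OF U(1) orb_invariant[OF U] orb_self[OF U]] by simp
qed

section \<open>Counting the orbits of each type\<close>

definition orbits_of_type :: "('a, 'x) gset \<Rightarrow> 'a gset_iso_class \<Rightarrow> 'x set set" where
  "orbits_of_type U t = orb U ` {x \<in> fst U. orbit_type U x = t}"

lemma orbits_of_type_image:
  assumes U: "finite_gset G U"
    and f: "inj_on f (fst U)" "\<And>g y. g \<in> carrier G \<Longrightarrow> y \<in> fst U \<Longrightarrow> f (snd U g y) = snd V g (f y)"
  shows "orb V ` {y \<in> f ` fst U. orbit_type V y = t} = (`) f ` orbits_of_type U t"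
    and "card ((`) f ` orbits_of_type U t) = card (orbits_of_type U t)"
proof -
  have "{y \<in> f ` fst U. orbit_type V y = t} = f ` {x \<in> fst U. orbit_type U x = t}"
    using orbit_type_image[OF U _ f] by auto
  then show "orb V ` {y \<in> f ` fst U. orbit_type V y = t} = (`) f ` orbits_of_type U t"
    unfolding orbits_of_type_def image_image
    by (simp add: image_image) (use orb_image[of f U _ V] f(2) in \<open>auto intro!: image_cong\<close>)
  have "orbits_of_type U t \<subseteq> Pow (fst U)"
    using orb_subset[OF U] by (auto simp: orbits_of_type_def)
  then show "card ((`) f ` orbits_of_type U t) = card (orbits_of_type U t)"
    using inj_on_image_Pow[OF f(1)] by (intro card_image) (rule inj_on_subset)
qed

lemma card_orbits_of_type_iso:
  assumes U: "finite_gset G U" and "gset_iso G U V"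
  shows "card (orbits_of_type V t) = card (orbits_of_type U t)"
proof -
  obtain f where f: "bij_betw f (fst U) (fst V)"
    "\<And>g y. g \<in> carrier G \<Longrightarrow> y \<in> fst U \<Longrightarrow> f (snd U g y) = snd V g (f y)"
    using assms(2) unfolding gset_iso_def by blast
  show ?thesis
    using orbits_of_type_image[OF U, of f V t] f by (simp add: bij_betw_def orbits_of_type_def)
qed

lemma finite_orbits_of_type: "finite_gset G U \<Longrightarrow> finite (orbits_of_type U t)"
  by (simp add: orbits_of_type_def finite_gset_finite)

lemma card_orbits_of_type_sum:
  fixes U :: "('a, 'u) gset" and V :: "('a, 'v) gset"
  assumes U: "finite_gset G U" and V: "finite_gset G V"
  shows "card (orbits_of_type (gset_sum U V) t) = card (orbits_of_type U t) + card (orbits_of_type V t)"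
proof -
  let ?W = "gset_sum U V"
  have l: "orb ?W ` {y \<in> Inl ` fst U. orbit_type ?W y = t} = (`) Inl ` orbits_of_type U t"
    "card ((`) Inl ` orbits_of_type U t :: ('u + 'v) set set) = card (orbits_of_type U t)"
    by (rule orbits_of_type_image(1)[OF U] orbits_of_type_image(2)[OF U, where V = ?W];
        simp add: gset_sum_def InlI)+
  have r: "orb ?W ` {y \<in> Inr ` fst V. orbit_type ?W y = t} = (`) Inr ` orbits_of_type V t"
    "card ((`) Inr ` orbits_of_type V t :: ('u + 'v) set set) = card (orbits_of_type V t)"
    by (rule orbits_of_type_image(1)[OF V] orbits_of_type_image(2)[OF V, where V = ?W];
        simp add: gset_sum_def InrI)+
  have "{z \<in> fst ?W. orbit_type ?W z = t} =
      {z \<in> Inl ` fst U. orbit_type ?W z = t} \<union> {z \<in> Inr ` fst V. orbit_type ?W z = t}"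
    by (auto simp: gset_sum_def)
  then have *: "orbits_of_type ?W t = (`) Inl ` orbits_of_type U t \<union> (`) Inr ` orbits_of_type V t"
    unfolding orbits_of_type_def[of ?W] by (simp only: image_Un l(1) r(1))
  \<comment> \<open>Images under \<open>Inl\<close> and \<open>Inr\<close> can coincide only when
    empty, and orbits contain their base point. Hence no orbit is counted in both summands.\<close>
  have "Q = {}" if "Inl ` P = Inr ` Q" for P :: "'u set" and Q :: "'v set"
    using that by auto
  then have "(`) Inl ` orbits_of_type U t \<inter> (`) Inr ` orbits_of_type V t = {}"
    using orb_self[OF V] unfolding orbits_of_type_def by fastforce
  then show ?thesis
    unfolding * by (simp add: card_Un_disjoint finite_orbits_of_type U V l(2) r(2))
qed

text \<open>Any member of the class may be chosen, because isomorphic G-sets have equally many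
  orbits of each type.\<close>

definition class_count :: "'a gset_iso_class \<Rightarrow> 'a gset_iso_class \<Rightarrow> nat" where
  "class_count t A = card (orbits_of_type (SOME U. U \<in> A) t)"

lemma class_count:
  assumes "finite_gset G U"
  shows "class_count t (gset_class G U) = card (orbits_of_type U t)"
proof -
  have "(SOME Z. Z \<in> gset_class G U) \<in> gset_class G U"
    using gset_class_nonempty[OF assms] by (simp add: some_in_eq)
  then show ?thesis
    unfolding class_count_def using card_orbits_of_type_iso gset_classD by metis
qed

lemma class_count_add:
  assumes "A \<in> carrier (gset_semiring G)" "B \<in> carrier (gset_semiring G)"
  shows "class_count t (A \<oplus>\<^bsub>gset_semiring G\<^esub> B) = class_count t A + class_count t B"
  using assms
  by (elim gset_carrierE) (simp add: gset_class_add class_count finite_gset_sum card_orbits_of_type_sum)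

text \<open>The index set of the basis. A definition cannot range over all types of points, hence
  the restriction to natural numbers; \<open>orbit_type_in_orbit_types\<close> shows that the orbit
  types of all other finite G-sets are included.\<close>

definition orbit_types :: "'a gset_iso_class set" where
  "orbit_types = {orbit_type U x | (U :: ('a, nat) gset) x. finite_gset G U \<and> x \<in> fst U}"

lemma orbit_type_in_orbit_types:
  assumes U: "finite_gset G U" "x \<in> fst U"
  shows "orbit_type U x \<in> orbit_types"
proof -
  obtain Z :: "('a, nat) gset" where Z: "finite_gset G Z" "gset_iso G Z U"
    using ex_nat_gset[OF U(1)] by metis
  then obtain f where f: "bij_betw f (fst Z) (fst U)"
    "\<And>g y. g \<in> carrier G \<Longrightarrow> y \<in> fst Z \<Longrightarrow> f (snd Z g y) = snd U g (f y)"
    unfolding gset_iso_def by blast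
  then obtain z where z: "z \<in> fst Z" "x = f z" using U(2) unfolding bij_betw_def by blast
  then have "orbit_type U x = orbit_type Z z"
    using orbit_type_image[OF Z(1) z(1) _ f(2)] f(1) by (simp add: bij_betw_def)
  then show ?thesis unfolding orbit_types_def using Z(1) z(1) by blast
qed

lemma orbit_types_closed:
  assumes "t \<in> orbit_types"
  shows "t \<in> carrier (gset_semiring G)"
proof -
  obtain U :: "('a, nat) gset" and x where "finite_gset G U" "x \<in> fst U" "t = orbit_type U x"
    using assms unfolding orbit_types_def by blast
  then show ?thesis by (simp add: orbit_type_closed)
qed

text \<open>Choosing a point in an orbit of each type and taking its stabilizer gives an injection
  into the subsets of \<open>G\<close>, by \<open>orbit_type_eq_of_stab\<close>.\<close>

lemma finite_orbit_types:
  assumes "finite (carrier G)"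
  shows "finite orbit_types"
proof -
  have "\<forall>t\<in>orbit_types. \<exists>U x. finite_gset G (U :: ('a, nat) gset) \<and> x \<in> fst U \<and> t = orbit_type U x"
    unfolding orbit_types_def by blast
  then obtain U x where Ux: "\<And>t. t \<in> orbit_types \<Longrightarrow> finite_gset G (U t :: ('a, nat) gset)"
    "\<And>t. t \<in> orbit_types \<Longrightarrow> x t \<in> fst (U t)" "\<And>t. t \<in> orbit_types \<Longrightarrow> t = orbit_type (U t) (x t)"
    by metis
  have "inj_on (\<lambda>t. stab (U t) (x t)) orbit_types"
    by (rule inj_onI) (metis Ux orbit_type_eq_of_stab)
  moreover have "(\<lambda>t. stab (U t) (x t)) ` orbit_types \<subseteq> Pow (carrier G)"
    by (auto simp: stabilizer_def)
  ultimately show ?thesis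
    using assms by (meson finite_Pow_iff inj_on_finite)
qed

lemma orbits_of_type_orbit:
  assumes U: "finite_gset G U" "x \<in> fst U"
  shows "orbits_of_type (gset_sub U (orb U x)) t = (if t = orbit_type U x then {orb U x} else {})"
proof -
  have "orb (gset_sub U (orb U x)) y = orb U x" "orbit_type (gset_sub U (orb U x)) y = orbit_type U x"
    if "y \<in> orb U x" for y
    using that orb_eq[OF U that] orbit_type_sub[OF U(1) orb_invariant[OF U] that]
    by (simp_all add: orb_sub orbit_type_def)
  then show ?thesis using orb_self[OF U] by (auto simp: orbits_of_type_def)
qed

text \<open>The counts are dual to the orbit types: a transitive G-set has a single orbit.\<close>

lemma class_count_orbit_type:
  assumes U: "finite_gset G U" "x \<in> fst U"
  shows "class_count t (orbit_type U x) = (if t = orbit_type U x then 1 else 0)"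
  unfolding orbit_type_def[of U x] class_count[OF finite_gset_sub[OF U(1) orb_invariant[OF U]]]
  using orbits_of_type_orbit[OF U] by (simp add: orbit_type_def)

lemma gset_class_induct [consumes 1, case_names zero orbit]:
  assumes U: "finite_gset G U" and "P \<zero>\<^bsub>gset_semiring G\<^esub>"
    and step: "\<And>A x. A \<in> carrier (gset_semiring G) \<Longrightarrow> x \<in> fst U \<Longrightarrow> P A \<Longrightarrow>
      P (A \<oplus>\<^bsub>gset_semiring G\<^esub> orbit_type U x)"
  shows "P (gset_class G U)"
proof -
  from U have "invariant U (fst U) \<and> P (gset_class G (gset_sub U (fst U)))"
  proof (induction rule: gset_induct)
    case empty
    then show ?case using assms(2) by (simp add: gset_class_sub_empty invariant_def)
  next
    case (orbit E x)
    then show ?case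
      using step[of "gset_class G (gset_sub U E)" x] orb_invariant[OF U orbit(2)]
      by (simp add: U gset_class_sub_Un invariant_Un Int_commute gset_class_closed finite_gset_sub orbit_type_def)
  qed
  then show ?thesis by (simp add: gset_class_sub_whole[OF U])
qed

section \<open>Orbits in products and the filtration by orbit size\<close>

lemma snd_gset_prod:
  "x \<in> fst U \<Longrightarrow> y \<in> fst V \<Longrightarrow> snd (gset_prod U V) g (x, y) = (snd U g x, snd V g y)"
  by (simp add: gset_prod_def)

lemma fst_gset_prod [simp]: "fst (gset_prod U V) = fst U \<times> fst V"
  by (simp add: gset_prod_def)

lemma stab_prod:
  "x \<in> fst U \<Longrightarrow> y \<in> fst V \<Longrightarrow> stab (gset_prod U V) (x, y) = stab U x \<inter> stab V y"
  by (auto simp: stabilizer_def snd_gset_prod)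

text \<open>The first projection is equivariant and maps the orbit of the pair onto the orbit of
  \<open>x\<close>.\<close>

lemma card_orb_prod_ge:
  assumes U: "finite_gset G U" and V: "finite_gset G V" and x: "x \<in> fst U" and y: "y \<in> fst V"
  shows "card (orb U x) \<le> card (orb (gset_prod U V) (x, y))"
proof -
  have "orb U x = fst ` orb (gset_prod U V) (x, y)"
    using x y by (force simp: orbit_def snd_gset_prod)
  moreover have "finite (orb (gset_prod U V) (x, y))"
    using orb_subset[OF finite_gset_prod[OF U V], of "(x, y)"] x y finite_gset_finite[OF finite_gset_prod[OF U V]]
    by (auto intro: finite_subset)
  ultimately show ?thesis by (simp add: card_image_le)
qed

text \<open>A step of the filtration by orbit size. By \<open>large_orbits_mult\<close> it absorbs
  products with arbitrary classes, like an ideal, which is what the induction on orbit size relies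
  on.\<close>

definition large_orbits :: "nat \<Rightarrow> 'a gset_iso_class \<Rightarrow> bool" where
  "large_orbits m A \<longleftrightarrow>
     (\<exists>U :: ('a, nat) gset. finite_gset G U \<and> A = gset_class G U \<and> (\<forall>x\<in>fst U. m < card (orb U x)))"

lemma large_orbitsI:
  assumes U: "finite_gset G U" and m: "\<And>x. x \<in> fst U \<Longrightarrow> m < card (orb U x)"
  shows "large_orbits m (gset_class G U)"
proof -
  obtain Z :: "('a, nat) gset" where Z: "finite_gset G Z" "gset_iso G Z U" "gset_class G Z = gset_class G U"
    using ex_nat_gset[OF U] by metis
  then obtain f where f: "bij_betw f (fst Z) (fst U)"
    "\<And>g y. g \<in> carrier G \<Longrightarrow> y \<in> fst Z \<Longrightarrow> f (snd Z g y) = snd U g (f y)"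
    unfolding gset_iso_def by blast
  have "m < card (orb Z z)" if z: "z \<in> fst Z" for z
  proof -
    have "orb U (f z) = f ` orb Z z" using f(2) z by (intro orb_image)
    moreover have "inj_on f (orb Z z)"
      using f(1) orb_subset[OF Z(1) z] unfolding bij_betw_def by (blast intro: inj_on_subset)
    ultimately show ?thesis
      using m[of "f z"] bij_betw_apply[OF f(1) z] by (simp add: card_image)
  qed
  then show ?thesis unfolding large_orbits_def using Z(1,3) by metis
qed

lemma large_orbits_mult:
  assumes "large_orbits m A" "B \<in> carrier (gset_semiring G)"
  shows "large_orbits m (A \<otimes>\<^bsub>gset_semiring G\<^esub> B)"
proof -
  obtain U :: "('a, nat) gset" where U: "finite_gset G U" "A = gset_class G U" "\<And>x. x \<in> fst U \<Longrightarrow> m < card (orb U x)"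
    using assms(1) unfolding large_orbits_def by blast
  obtain V :: "('a, nat) gset" where V: "finite_gset G V" "B = gset_class G V"
    using assms(2) by (rule gset_carrierE)
  have "large_orbits m (gset_class G (gset_prod U V))"
  proof (rule large_orbitsI[OF finite_gset_prod[OF U(1) V(1)]])
    fix p assume "p \<in> fst (gset_prod U V)"
    then obtain x y where "p = (x, y)" "x \<in> fst U" "y \<in> fst V" by auto
    then show "m < card (orb (gset_prod U V) p)"
      using U(3) card_orb_prod_ge[OF U(1) V(1)] less_le_trans by blast
  qed
  then show ?thesis using U V by (simp add: gset_class_mult)
qed

lemma large_orbits_induct [consumes 1, case_names zero orbit]:
  assumes A: "large_orbits m A" and "P \<zero>\<^bsub>gset_semiring G\<^esub>"
    and step: "\<And>A (U :: ('a, nat) gset) x. A \<in> carrier (gset_semiring G) \<Longrightarrow> finite_gset G U \<Longrightarrow> x \<in> fst U \<Longrightarrow>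
      m < card (orb U x) \<Longrightarrow> P A \<Longrightarrow> P (A \<oplus>\<^bsub>gset_semiring G\<^esub> orbit_type U x)"
  shows "P A"
proof -
  obtain U :: "('a, nat) gset" where U: "finite_gset G U" "A = gset_class G U" "\<And>x. x \<in> fst U \<Longrightarrow> m < card (orb U x)"
    using A unfolding large_orbits_def by blast
  show ?thesis unfolding U(2) using U(1)
    by (rule gset_class_induct) (use assms(2) step U(1,3) in auto)
qed

text \<open>In the coset space of a subgroup H, with \<open>x\<close> the trivial coset, these
  points are the cosets contained in the normalizer of H.\<close>

definition same_stab :: "('a, 'x) gset \<Rightarrow> 'x \<Rightarrow> 'x set" where
  "same_stab U x = {y \<in> fst U. stab U y = stab U x}"

text \<open>Stabilizers are conjugated by \<open>g\<close> when points are translated by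
  \<open>g\<close>, so equality of stabilizers is preserved.\<close>

lemma stab_translate:
  assumes U: "finite_gset G U" "x \<in> fst U" "y \<in> fst U" and g: "g \<in> carrier G"
    and eq: "stab U x = stab U y"
  shows "stab U (snd U g x) = stab U (snd U g y)"
proof -
  have "h \<in> stab U (snd U g z) \<longleftrightarrow> h \<in> carrier G \<and> inv g \<otimes> (h \<otimes> g) \<in> stab U z" if "z \<in> fst U" for h z
    using gset_action_eq_iff[OF U(1) that, of "h \<otimes> g" g] that U(1) g
    by (auto simp: stabilizer_def gset_mult)
  then show ?thesis using U eq by blast
qed

lemma card_same_stab_le:
  assumes U: "finite_gset G U" "x \<in> fst U" and g: "g \<in> carrier G"
  shows "card (same_stab U x) \<le> card (same_stab U (snd U g x))"
proof (rule card_inj_on_le[where f = "snd U g"])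
  show "inj_on (snd U g) (same_stab U x)"
    using gset_inv_left[OF U(1) g] by (metis (no_types, lifting) CollectD inj_onI same_stab_def)
  show "snd U g ` same_stab U x \<subseteq> same_stab U (snd U g x)"
  proof clarify
    fix y assume "y \<in> same_stab U x"
    then have "y \<in> fst U" "stab U y = stab U x" by (auto simp: same_stab_def)
    then show "snd U g y \<in> same_stab U (snd U g x)"
      using stab_translate[OF U(1) _ U(2) g] gset_closed[OF U(1) g] by (simp add: same_stab_def)
  qed
  show "finite (same_stab U (snd U g x))"
    using finite_gset_finite[OF U(1)] by (simp add: same_stab_def)
qed

lemma card_same_stab:
  assumes U: "finite_gset G U" "x \<in> fst U" and y: "y \<in> orb U x"
  shows "card (same_stab U y) = card (same_stab U x)"
proof -
  obtain g where g: "g \<in> carrier G" "y = snd U g x" using y by (auto simp: orbit_def)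
  then have "snd U (inv g) y = x" using gset_inv_left[OF U(1) g(1) U(2)] by simp
  then show ?thesis
    using card_same_stab_le[OF U g(1)] card_same_stab_le[OF U(1), of y "inv g"] g gset_closed[OF U(1) g(1) U(2)]
    by simp
qed

text \<open>The fibres of the stabilizer map partition \<open>U\<close>, and translation in the
  single orbit shows that all have the same size. That size divides the number of points, which
  divides the order of \<open>G\<close> by the orbit-stabilizer theorem.\<close>

lemma card_same_stab_dvd:
  assumes U: "finite_gset G U" "x \<in> fst U" and trans: "orb U x = fst U"
  shows "card (same_stab U x) dvd order G"
proof -
  have fin: "finite (fst U)" by (rule finite_gset_finite[OF U(1)])
  have "card (fst U) = (\<Sum>y\<in>fst U. 1)" by simp
  also have "\<dots> = (\<Sum>K\<in>stab U ` fst U. \<Sum>y\<in>{y \<in> fst U. stab U y = K}. 1)"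
    using fin by (rule sum.image_gen)
  also have "\<dots> = (\<Sum>K\<in>stab U ` fst U. card (same_stab U x))"
  proof (rule sum.cong[OF refl])
    fix K assume "K \<in> stab U ` fst U"
    then obtain z where z: "z \<in> fst U" "K = stab U z" by blast
    then have "(\<Sum>y\<in>{y \<in> fst U. stab U y = K}. 1) = card (same_stab U z)" by (simp add: same_stab_def)
    then show "(\<Sum>y\<in>{y \<in> fst U. stab U y = K}. 1) = card (same_stab U x)"
      using card_same_stab[OF U] z trans by simp
  qed
  finally have "card (same_stab U x) dvd card (fst U)" by simp
  then show ?thesis
    using orbit_stabilizer[OF U] trans by (metis dvd_mult2)
qed

lemma card_orb_eq_of_stab:
  assumes fin: "finite (carrier G)" and U: "finite_gset G U" "x \<in> fst U" and V: "finite_gset G V" "y \<in> fst V"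
    and eq: "stab U x = stab V y"
  shows "card (orb U x) = card (orb V y)"
proof -
  have "0 < order G" using fin by (simp add: order_gt_0_iff_finite)
  then show ?thesis using orbit_stabilizer[OF U] orbit_stabilizer[OF V] eq
    by (metis mult_cancel2 mult_is_0 not_gr_zero)
qed

lemma card_orb_less_of_stab:
  assumes fin: "finite (carrier G)" and U: "finite_gset G U" "x \<in> fst U" and V: "finite_gset G V" "y \<in> fst V"
    and sub: "stab V y \<subset> stab U x"
  shows "card (orb U x) < card (orb V y)"
proof -
  have "finite (stab U x)" using fin by (simp add: stabilizer_def)
  then have less: "card (stab V y) < card (stab U x)" using sub by (rule psubset_card_mono)
  have "0 < order G" using fin by (simp add: order_gt_0_iff_finite)
  then have "0 < card (orb V y)" using orbit_stabilizer[OF V] by (metis mult_is_0 not_gr_zero)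
  with less have "card (orb V y) * card (stab V y) < card (orb V y) * card (stab U x)" by simp
  then have "card (orb U x) * card (stab U x) < card (orb V y) * card (stab U x)"
    using orbit_stabilizer[OF U] orbit_stabilizer[OF V] by simp
  then show ?thesis by simp
qed

text \<open>Orbits in the square of a transitive \<open>G\<close>-set are at least as large as the set itself. Those
  of equal size consist of the pairs of points with the same stabilizer, and each of them is
  isomorphic to the \<open>G\<close>-set.\<close>

lemma transitive_square:
  assumes fin: "finite (carrier G)" and U: "finite_gset G U" "x \<in> fst U" and trans: "orb U x = fst U"
  obtains n L where "n dvd order G" "L \<in> carrier (gset_semiring G)" "large_orbits (card (fst U)) L"
    "gset_class G U \<otimes>\<^bsub>gset_semiring G\<^esub> gset_class G U =
       [(n :: nat)] \<cdot>\<^bsub>gset_semiring G\<^esub> gset_class G U \<oplus>\<^bsub>gset_semiring G\<^esub> L"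
proof -
  interpret S: csemiring "gset_semiring G" by (rule csemiring_gset_semiring)
  let ?V = "gset_prod U U" and ?c = "gset_class G U"
  define W where "W = Sigma (fst U) (same_stab U)"
  define n where "n = card (same_stab U x)"
  have V: "finite_gset G ?V" by (intro finite_gset_prod U)
  have finU: "finite (fst U)" by (rule finite_gset_finite[OF U(1)])
  have orbU: "orb U y = fst U" if "y \<in> fst U" for y
    using orb_eq[OF U] trans that by simp
  have W: "invariant ?V W"
    unfolding invariant_def
  proof (intro conjI ballI)
    fix g p assume g: "g \<in> carrier G" and "p \<in> W"
    then obtain y z where p: "p = (y, z)" "y \<in> fst U" "z \<in> fst U" "stab U z = stab U y"
      by (auto simp: W_def same_stab_def)
    then show "snd ?V g p \<in> W"
      using stab_translate[OF U(1) p(3,2) g p(4)] gset_closed[OF U(1) g]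
      by (simp add: W_def same_stab_def snd_gset_prod)
  qed (auto simp: W_def same_stab_def)
  have whole: "invariant ?V (fst ?V)" using gset_closed[OF V] unfolding invariant_def by blast
  have W': "invariant ?V (fst ?V - W)" by (intro invariant_Diff V whole W)
  have WV: "W \<union> (fst ?V - W) = fst ?V" using invariantD(1)[OF W] by blast
  let ?X = "gset_sub ?V W" and ?L = "gset_class G (gset_sub ?V (fst ?V - W))"
  have X: "finite_gset G ?X" by (intro finite_gset_sub V W)
  \<comment> \<open>The stabilizer of a pair is the intersection of both stabilizers, here just
    \<open>stab U y\<close>. Hence the orbit of the pair is a copy of the orbit of \<open>y\<close>,
    which is all of \<open>U\<close>.\<close>
  have orbX: "orbit_type ?X p = ?c" "card (orb ?X p) = card (fst U)" if pW: "p \<in> W" for p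
  proof -
    obtain y z where p: "p = (y, z)" "y \<in> fst U" "z \<in> fst U" "stab U z = stab U y"
      using pW by (auto simp: W_def same_stab_def)
    then have st: "stab ?X p = stab U y" using pW by (simp add: stab_sub stab_prod)
    show "orbit_type ?X p = ?c"
      using orbit_type_eq_of_stab[OF X _ U(1) p(2) st] that
      by (simp add: orbit_type_def orbU[OF p(2)] gset_class_sub_whole[OF U(1)])
    show "card (orb ?X p) = card (fst U)"
      using card_orb_eq_of_stab[OF fin X _ U(1) p(2) st] that by (simp add: orbU[OF p(2)])
  qed
  have c: "?c \<in> carrier (gset_semiring G)" by (intro gset_class_closed U)
  \<comment> \<open>The multiplicity \<open>k\<close> is recorded together with the cardinality, so
    that a second count of the points of \<open>W\<close> can identify it.\<close>
  from X have "finite (fst ?X) \<and> invariant ?X (fst ?X) \<and> (\<exists>k. card (fst ?X) = k * card (fst U) \<and>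
      gset_class G (gset_sub ?X (fst ?X)) = [k] \<cdot>\<^bsub>gset_semiring G\<^esub> ?c)"
  proof (induction rule: gset_induct)
    case empty
    then show ?case by (auto intro!: exI[of _ 0] simp: gset_class_sub_empty invariant_def)
  next
    case (orbit E p)
    then obtain k where k: "card E = k * card (fst U)"
      "gset_class G (gset_sub ?X E) = [k] \<cdot>\<^bsub>gset_semiring G\<^esub> ?c" by blast
    have inv: "invariant ?X (orb ?X p)" by (intro orb_invariant X orbit)
    then have "finite (orb ?X p)"
      using finite_gset_finite[OF X] invariantD(1) by (blast intro: finite_subset)
    then have "card (E \<union> orb ?X p) = Suc k * card (fst U)"
      using orbit k(1) orbX(2)[of p] by (simp add: card_Un_disjoint Int_commute)
    moreover have "gset_class G (gset_sub ?X (E \<union> orb ?X p)) = [Suc k] \<cdot>\<^bsub>gset_semiring G\<^esub> ?c"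
      using orbit inv k(2) orbX(1)[of p]
      by (simp add: gset_class_sub_Un[OF X] Int_commute orbit_type_def)
    ultimately show ?case
      using orbit inv \<open>finite (orb ?X p)\<close> by (intro conjI exI[of _ "Suc k"]) (auto intro: invariant_Un)
  qed
  then obtain k where k: "card W = k * card (fst U)" "gset_class G ?X = [k] \<cdot>\<^bsub>gset_semiring G\<^esub> ?c"
    using gset_class_sub_whole[OF X] by auto
  \<comment> \<open>Over each first coordinate, \<open>W\<close> has \<open>n\<close> points.
    Comparison with \<open>k\<close> copies of the nonempty set \<open>U\<close> gives
    \<open>k = n\<close>.\<close>
  have "card W = (\<Sum>y\<in>fst U. card (same_stab U y))"
    unfolding W_def using finU by (intro card_SigmaI) (auto simp: same_stab_def)
  also have "\<dots> = card (fst U) * n"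
    using card_same_stab[OF U] trans by (simp add: n_def)
  finally have "k = n"
    using k(1) U(2) finU by (auto simp: card_gt_0_iff)
  then have kn: "k dvd order G"
    using card_same_stab_dvd[OF U trans] by (simp add: n_def)
  have "?c \<otimes>\<^bsub>gset_semiring G\<^esub> ?c = gset_class G (gset_sub ?V (fst ?V))"
    by (simp only: gset_class_mult[OF U(1) U(1)] gset_class_sub_whole[OF V])
  also have "\<dots> = gset_class G ?X \<oplus>\<^bsub>gset_semiring G\<^esub> ?L"
    using gset_class_sub_Un[OF V W W'] unfolding WV by blast
  finally have sq: "?c \<otimes>\<^bsub>gset_semiring G\<^esub> ?c = [k] \<cdot>\<^bsub>gset_semiring G\<^esub> ?c \<oplus>\<^bsub>gset_semiring G\<^esub> ?L"
    unfolding k(2) .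
  have "large_orbits (card (fst U)) ?L"
  proof (rule large_orbitsI[OF finite_gset_sub[OF V W']])
    fix p assume "p \<in> fst (gset_sub ?V (fst ?V - W))"
    then have pW: "p \<in> fst ?V - W" by simp
    then obtain y z where p: "p = (y, z)" "y \<in> fst U" "z \<in> fst U" by auto
    have ne: "stab U z \<noteq> stab U y" using pW p by (simp add: W_def same_stab_def)
    \<comment> \<open>Both points have the same orbit, so their stabilizers have equal order. Being
      different, neither contains the other, and their intersection, the stabilizer of the pair, is
      strictly smaller: the orbit is strictly larger than \<open>U\<close>.\<close>
    have "card (orb U y) * card (stab U y) = card (orb U z) * card (stab U z)"
      using orbit_stabilizer[OF U(1)] p by simp
    then have "card (stab U y) = card (stab U z)"
      using U(2) finU by (auto simp: orbU p(2,3))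
    moreover have "finite (stab U z)" using fin by (simp add: stabilizer_def)
    ultimately have "\<not> stab U y \<subseteq> stab U z" using ne by (metis card_subset_eq)
    then have "stab (gset_sub ?V (fst ?V - W)) p \<subset> stab U y"
      using pW p(1-3) by (auto simp: stab_sub stab_prod)
    then have "card (orb U y) < card (orb (gset_sub ?V (fst ?V - W)) p)"
      using pW by (intro card_orb_less_of_stab[OF fin U(1) p(2) finite_gset_sub[OF V W']]) simp
    then show "card (fst U) < card (orb (gset_sub ?V (fst ?V - W)) p)"
      by (simp add: orbU[OF p(2)])
  qed
  moreover have "?L \<in> carrier (gset_semiring G)" by (intro gset_class_closed finite_gset_sub V W')
  ultimately show ?thesis using that kn sq by blast
qed

end


section \<open>Derivations of the Burnside algebra\<close>

lemma (in cring) derivation_eq_zero: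
  assumes d_closed: "\<And>x. x \<in> carrier R \<Longrightarrow> d x \<in> carrier R"
    and d_add: "\<And>x y. x \<in> carrier R \<Longrightarrow> y \<in> carrier R \<Longrightarrow> d (x \<oplus> y) = d x \<oplus> d y"
    and d_mult: "\<And>x y. x \<in> carrier R \<Longrightarrow> y \<in> carrier R \<Longrightarrow> d (x \<otimes> y) = x \<otimes> d y \<oplus> d x \<otimes> y"
    and tf: "\<And>x. x \<in> carrier R \<Longrightarrow> [(n :: nat)] \<cdot> x = \<zero> \<Longrightarrow> x = \<zero>"
    and a: "a \<in> carrier R" and l: "l \<in> carrier R"
    and sq: "a \<otimes> a = [n] \<cdot> a \<oplus> l" and dl: "d l = \<zero>" and dla: "d (l \<otimes> a) = \<zero>"
  shows "d a = \<zero>"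
proof -
  interpret d: abelian_group_hom R R d
    by (rule abelian_group_hom_addI) (use is_abelian_group d_closed d_add in auto)
  define y where "y = d a"
  have y: "y \<in> carrier R" using a d_closed by (simp add: y_def)
  \<comment> \<open>The Leibniz rule for \<open>l\<close> times \<open>a\<close> has one surviving
    term, because \<open>d l\<close> vanishes.\<close>
  have ly: "l \<otimes> y = \<zero>"
    using d_mult[OF l a] dl dla a l y by (simp add: y_def)
  have "d (a \<otimes> a) = [n] \<cdot> y"
    unfolding sq using a l dl y by (simp add: d.hom_add_pow_nat y_def)
  then have ny: "[n] \<cdot> y = a \<otimes> y \<oplus> a \<otimes> y"
    using d_mult[OF a a] a y by (simp add: y_def m_comm)
  have "a \<otimes> (a \<otimes> y) = ([n] \<cdot> a \<oplus> l) \<otimes> y"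
    using a y by (simp flip: sq add: m_assoc)
  also have "\<dots> = [n] \<cdot> (a \<otimes> y)"
    using a l y ly by (simp add: l_distr add_pow_ldistr)
  \<comment> \<open>Now \<open>a\<close> times the relation \<open>ny\<close> is evaluated: one side
    is \<open>n\<close> times \<open>a y\<close>, the other is twice that element. Cancelling one
    copy needs subtraction only.\<close>
  finally have "[n] \<cdot> (a \<otimes> y) \<oplus> [n] \<cdot> (a \<otimes> y) = a \<otimes> (a \<otimes> y \<oplus> a \<otimes> y)"
    using a y by (simp add: r_distr)
  also have "\<dots> = [n] \<cdot> (a \<otimes> y)"
    using a y by (simp flip: ny add: add_pow_rdistr)
  finally have "[n] \<cdot> (a \<otimes> y) = \<zero>"
    using a y by (metis add.nat_pow_closed m_closed add.l_cancel_one')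
  then have "a \<otimes> y = \<zero>" using tf a y by blast
  then have "[n] \<cdot> y = \<zero>" using ny by simp
  then show ?thesis using tf y by (simp add: y_def)
qed

section \<open>The Burnside ring and its orbit coordinates\<close>

context group
begin

interpretation S: csemiring "gset_semiring G"
  by (rule csemiring_gset_semiring)

abbreviation burnside_class :: "'a gset_iso_class \<Rightarrow> ('a gset_iso_class \<times> 'a gset_iso_class) set" where
  "burnside_class A \<equiv> S.groth A \<zero>\<^bsub>gset_semiring G\<^esub>"

lemma cring_burnside_ring: "cring (burnside_ring G)"
  unfolding burnside_ring_def by (rule S.cring_grothendieck_ring)

interpretation B: cring "burnside_ring G"
  by (rule cring_burnside_ring)

lemma burnside_class_closed: "A \<in> carrier (gset_semiring G) \<Longrightarrow> burnside_class A \<in> carrier (burnside_ring G)"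
  by (simp add: burnside_ring_def S.groth_closed)

lemma burnside_class_add:
  "A \<in> carrier (gset_semiring G) \<Longrightarrow> A' \<in> carrier (gset_semiring G) \<Longrightarrow>
     burnside_class (A \<oplus>\<^bsub>gset_semiring G\<^esub> A') = burnside_class A \<oplus>\<^bsub>burnside_ring G\<^esub> burnside_class A'"
  by (simp add: burnside_ring_def S.groth_add)

lemma burnside_class_mult:
  "A \<in> carrier (gset_semiring G) \<Longrightarrow> A' \<in> carrier (gset_semiring G) \<Longrightarrow>
     burnside_class (A \<otimes>\<^bsub>gset_semiring G\<^esub> A') = burnside_class A \<otimes>\<^bsub>burnside_ring G\<^esub> burnside_class A'"
  by (simp add: burnside_ring_def S.groth_mult)

lemma burnside_class_zero: "burnside_class \<zero>\<^bsub>gset_semiring G\<^esub> = \<zero>\<^bsub>burnside_ring G\<^esub>"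
  by (simp add: burnside_ring_def S.groth_zero)

lemma burnside_carrierE:
  assumes "b \<in> carrier (burnside_ring G)"
  obtains A A' where "A \<in> carrier (gset_semiring G)" "A' \<in> carrier (gset_semiring G)"
    "b = burnside_class A \<ominus>\<^bsub>burnside_ring G\<^esub> burnside_class A'"
  using assms unfolding burnside_ring_def by (metis S.groth_carrierE S.groth_minus)

text \<open>The coordinate \<open>C t\<close> is the additive extension of the number of orbits of
  type \<open>t\<close>. The recovery map \<open>?e\<close> is additive and fixes each orbit type by
  duality, hence fixes all classes of G-sets and their differences.\<close>

lemma burnside_orbit_coordinates:
  assumes fin: "finite (carrier G)"
  obtains C :: "'a gset_iso_class \<Rightarrow> ('a gset_iso_class \<times> 'a gset_iso_class) set \<Rightarrow> int"
  where "\<And>t b c. b \<in> carrier (burnside_ring G) \<Longrightarrow> c \<in> carrier (burnside_ring G) \<Longrightarrow>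
      C t (b \<oplus>\<^bsub>burnside_ring G\<^esub> c) = C t b + C t c"
    "\<And>b. b \<in> carrier (burnside_ring G) \<Longrightarrow>
      b = (\<Oplus>\<^bsub>burnside_ring G\<^esub>t\<in>orbit_types. [C t b] \<cdot>\<^bsub>burnside_ring G\<^esub> burnside_class t)"
proof -
  let ?B = "burnside_ring G"
  have "\<exists>C. (\<forall>b\<in>carrier ?B. \<forall>c\<in>carrier ?B. C (b \<oplus>\<^bsub>?B\<^esub> c) = C b + C c) \<and>
      (\<forall>A\<in>carrier (gset_semiring G). C (burnside_class A) = int (class_count t A))" for t
    by (rule S.ex_groth_extension[of "\<lambda>A. int (class_count t A)"])
      (auto simp: class_count_add burnside_ring_def)
  then obtain C where C_add: "\<And>t b c. b \<in> carrier ?B \<Longrightarrow> c \<in> carrier ?B \<Longrightarrow> C t (b \<oplus>\<^bsub>?B\<^esub> c) = C t b + C t c"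
    and C: "\<And>t A. A \<in> carrier (gset_semiring G) \<Longrightarrow> C t (burnside_class A) = int (class_count t A)"
    by metis
  let ?e = "\<lambda>b. \<Oplus>\<^bsub>?B\<^esub>t\<in>orbit_types. [C t b] \<cdot>\<^bsub>?B\<^esub> burnside_class t"
  have summands: "(\<lambda>t. [C t b] \<cdot>\<^bsub>?B\<^esub> burnside_class t) \<in> orbit_types \<rightarrow> carrier ?B" for b
    by (auto simp: orbit_types_closed burnside_class_closed)
  interpret e: abelian_group_hom ?B ?B ?e
  proof (rule abelian_group_hom_addI)
    fix b c assume bc: "b \<in> carrier ?B" "c \<in> carrier ?B"
    have "?e (b \<oplus>\<^bsub>?B\<^esub> c) = (\<Oplus>\<^bsub>?B\<^esub>t\<in>orbit_types. [C t b] \<cdot>\<^bsub>?B\<^esub> burnside_class t \<oplus>\<^bsub>?B\<^esub> [C t c] \<cdot>\<^bsub>?B\<^esub> burnside_class t)"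
      by (rule B.finsum_cong') (use bc in \<open>auto simp: C_add B.add.int_pow_mult orbit_types_closed burnside_class_closed\<close>)
    also have "\<dots> = ?e b \<oplus>\<^bsub>?B\<^esub> ?e c" by (intro B.finsum_addf summands)
    finally show "?e (b \<oplus>\<^bsub>?B\<^esub> c) = ?e b \<oplus>\<^bsub>?B\<^esub> ?e c" .
  qed (use B.is_abelian_group summands in \<open>auto intro!: B.finsum_closed\<close>)
  have zero_pow: "[(0 :: int)] \<cdot>\<^bsub>?B\<^esub> b = \<zero>\<^bsub>?B\<^esub>" for b
    by (simp add: add_pow_def)
  have cls: "burnside_class A = ?e (burnside_class A)" if "A \<in> carrier (gset_semiring G)" for A
  proof -
    obtain U :: "('a, nat) gset" where U: "finite_gset G U" "A = gset_class G U"
      using \<open>A \<in> carrier (gset_semiring G)\<close> by (rule gset_carrierE)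
    from U(1) show ?thesis unfolding U(2)
    proof (induction rule: gset_class_induct)
      case zero
      show ?case unfolding burnside_class_zero by (rule e.hom_zero[symmetric])
    next
      case (orbit A x)
      let ?t = "orbit_type U x"
      have t: "?t \<in> carrier (gset_semiring G)" "?t \<in> orbit_types"
        by (rule orbit_type_closed[OF U(1) orbit(2)], rule orbit_type_in_orbit_types[OF U(1) orbit(2)])
      \<comment> \<open>By \<open>class_count_orbit_type\<close> the coefficients are 1 at
        \<open>?t\<close> and 0 elsewhere, so the sum has a single term.\<close>
      have "?e (burnside_class ?t) = (\<Oplus>\<^bsub>?B\<^esub>t\<in>orbit_types. if ?t = t then burnside_class t else \<zero>\<^bsub>?B\<^esub>)"
        by (rule B.finsum_cong')
          (auto simp: zero_pow C[OF t(1)] class_count_orbit_type[OF U(1) orbit(2)] orbit_types_closed burnside_class_closed)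
      also have "\<dots> = burnside_class ?t"
        by (rule B.add.finprod_singleton[OF t(2) finite_orbit_types[OF fin]])
          (auto simp: orbit_types_closed burnside_class_closed)
      finally have "?e (burnside_class ?t) = burnside_class ?t" .
      then show ?case
        using orbit t(1) e.hom_add[of "burnside_class A" "burnside_class ?t"]
        by (simp add: burnside_class_add burnside_class_closed)
    qed
  qed
  have "b = ?e b" if "b \<in> carrier ?B" for b
  proof -
    obtain A A' where A: "A \<in> carrier (gset_semiring G)" "A' \<in> carrier (gset_semiring G)"
      "b = burnside_class A \<ominus>\<^bsub>?B\<^esub> burnside_class A'"
      using \<open>b \<in> carrier ?B\<close> by (rule burnside_carrierE)
    then show ?thesis
      using e.hom_minus[of "burnside_class A" "burnside_class A'"] cls[OF A(1)] cls[OF A(2)]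
      by (simp add: burnside_class_closed)
  qed
  then show ?thesis using that C_add by blast
qed

end

lemma (in group) burnside_derivation_eq_zero:
  fixes R :: "('r, 'm) ring_scheme"
  assumes R: "cring R" and fin: "finite (carrier G)"
    and tf: "\<And>r. r \<in> carrier R \<Longrightarrow> [order G] \<cdot>\<^bsub>R\<^esub> r = \<zero>\<^bsub>R\<^esub> \<Longrightarrow> r = \<zero>\<^bsub>R\<^esub>"
    and d: "d \<in> derivations R (burnside_algebra R G)"
    and x: "x \<in> carrier (burnside_algebra R G)"
  shows "d x = \<zero>\<^bsub>burnside_algebra R G\<^esub>"
proof -
  let ?S = "gset_semiring G" and ?B = "burnside_ring G"
  interpret S: csemiring ?S by (rule csemiring_gset_semiring)
  interpret tensor R ?B using R cring_burnside_ring by (simp add: tensor_def)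
  note alg = burnside_algebra_def tensor_algebra_def
  have d_closed: "d y \<in> carrier T" if "y \<in> carrier T" for y
    using d that by (auto simp: derivations_def alg)
  have d_add: "d (y \<oplus>\<^bsub>T\<^esub> z) = d y \<oplus>\<^bsub>T\<^esub> d z" if "y \<in> carrier T" "z \<in> carrier T" for y z
    using d that by (auto simp: derivations_def alg)
  have d_mult: "d (y \<otimes>\<^bsub>T\<^esub> z) = y \<otimes>\<^bsub>T\<^esub> d z \<oplus>\<^bsub>T\<^esub> d y \<otimes>\<^bsub>T\<^esub> z" if "y \<in> carrier T" "z \<in> carrier T" for y z
    using d that by (auto simp: derivations_def alg)
  have d_smult: "d (pure r \<one>\<^bsub>?B\<^esub> \<otimes>\<^bsub>T\<^esub> y) = pure r \<one>\<^bsub>?B\<^esub> \<otimes>\<^bsub>T\<^esub> d y" if "r \<in> carrier R" "y \<in> carrier T" for r y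
    using d that by (auto simp: derivations_def alg)
  interpret d: abelian_group_hom T T d
    by (rule abelian_group_hom_addI) (use T.is_abelian_group d_closed d_add in auto)
  obtain C :: "'a gset_iso_class \<Rightarrow> _ \<Rightarrow> int"
    where C: "\<And>t b c. b \<in> carrier ?B \<Longrightarrow> c \<in> carrier ?B \<Longrightarrow> C t (b \<oplus>\<^bsub>?B\<^esub> c) = C t b + C t c"
      "\<And>b. b \<in> carrier ?B \<Longrightarrow> b = (\<Oplus>\<^bsub>?B\<^esub>t\<in>orbit_types. [C t b] \<cdot>\<^bsub>?B\<^esub> burnside_class t)"
    using burnside_orbit_coordinates[OF fin] by blast
  \<comment> \<open>If \<open>n\<close> divides the order of \<open>G\<close> and kills
    \<open>y\<close>, then the order of \<open>G\<close> kills \<open>y\<close> as well, so the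
    hypothesis on \<open>R\<close> covers every \<open>n\<close> that arises from a transitive
    square.\<close>
  have T_tf: "y = \<zero>\<^bsub>T\<^esub>" if "n dvd order G" "y \<in> carrier T" "[n] \<cdot>\<^bsub>T\<^esub> y = \<zero>\<^bsub>T\<^esub>" for y and n :: nat
  proof -
    obtain m where "order G = n * m" using \<open>n dvd order G\<close> by (rule dvdE)
    then have "[order G] \<cdot>\<^bsub>T\<^esub> y = \<zero>\<^bsub>T\<^esub>"
      using T.add.nat_pow_pow[of y m n] that(2,3) by simp
    note ny = this
    show ?thesis
    proof (rule tensor_torsion_free[where C = C and I = orbit_types and a = burnside_class and n = "order G"])
      show "b = (\<Oplus>\<^bsub>?B\<^esub>t\<in>orbit_types. [C t b] \<cdot>\<^bsub>?B\<^esub> burnside_class t)" if "b \<in> carrier ?B" for b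
        using that by (rule C(2))
    qed (use ny that(2) C(1) tf in \<open>simp_all add: orbit_types_closed burnside_class_closed\<close>)
  qed
  define \<theta> where "\<theta> A = pure \<one>\<^bsub>R\<^esub> (burnside_class A)" for A
  have \<theta>_closed: "\<theta> A \<in> carrier T" if "A \<in> carrier ?S" for A
    using that by (simp add: \<theta>_def pure_closed burnside_class_closed)
  have \<theta>_add: "\<theta> (A \<oplus>\<^bsub>?S\<^esub> A') = \<theta> A \<oplus>\<^bsub>T\<^esub> \<theta> A'" if "A \<in> carrier ?S" "A' \<in> carrier ?S" for A A'
    using that by (simp add: \<theta>_def burnside_class_add pure_add_right burnside_class_closed)
  have \<theta>_mult: "\<theta> (A \<otimes>\<^bsub>?S\<^esub> A') = \<theta> A \<otimes>\<^bsub>T\<^esub> \<theta> A'" if "A \<in> carrier ?S" "A' \<in> carrier ?S" for A A'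
    using that by (simp add: \<theta>_def burnside_class_mult pure_mult burnside_class_closed)
  have \<theta>_zero: "\<theta> \<zero>\<^bsub>?S\<^esub> = \<zero>\<^bsub>T\<^esub>"
    using abelian_group_hom.hom_zero[OF pure_hom_right[OF R.one_closed]] by (simp add: \<theta>_def burnside_class_zero)
  have \<theta>_pow: "\<theta> ([k] \<cdot>\<^bsub>?S\<^esub> A) = [k] \<cdot>\<^bsub>T\<^esub> \<theta> A" if "A \<in> carrier ?S" for A and k :: nat
    by (induction k) (use that in \<open>simp_all add: \<theta>_zero \<theta>_add\<close>)
  have d_orbit: "d (\<theta> (orbit_type U x)) = \<zero>\<^bsub>T\<^esub>" if "finite_gset G U" "x \<in> fst U" for U :: "('a, nat) gset" and x
    using that
  \<comment> \<open>Orbit sizes are divisors of the order of \<open>G\<close> and hence bounded by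
    it. Thus this truncated difference strictly decreases when the orbit grows.\<close>
  proof (induction "order G - card (orb U x)" arbitrary: U x rule: less_induct)
    case less
    let ?V = "gset_sub U (orb U x)" and ?t = "orbit_type U x"
    have V: "finite_gset G ?V" by (intro finite_gset_sub orb_invariant less)
    have xV: "x \<in> orb U x" by (intro orb_self less)
    \<comment> \<open>The orbit of \<open>x\<close>, regarded as a G-set of its own, is transitive,
      as \<open>transitive_square\<close> requires.\<close>
    then obtain n L where n: "n dvd order G" and L: "L \<in> carrier ?S" "large_orbits (card (orb U x)) L"
      and sq: "?t \<otimes>\<^bsub>?S\<^esub> ?t = [(n :: nat)] \<cdot>\<^bsub>?S\<^esub> ?t \<oplus>\<^bsub>?S\<^esub> L"
      using transitive_square[OF fin V, of x] by (auto simp: orb_sub orbit_type_def)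
    have t: "?t \<in> carrier ?S" by (intro orbit_type_closed less)
    \<comment> \<open>All orbits in \<open>A\<close> are larger than that of \<open>x\<close>, so
      the induction hypothesis applies to each and additivity to their sum. This is used for
      \<open>L\<close> and for its product with \<open>?t\<close>.\<close>
    have large: "A \<in> carrier ?S \<and> d (\<theta> A) = \<zero>\<^bsub>T\<^esub>" if "large_orbits (card (orb U x)) A" for A
      using that
    proof (induction rule: large_orbits_induct)
      case zero
      show ?case using d.hom_zero by (simp add: \<theta>_zero)
    next
      case (orbit A U' x')
      have "card (orb U' x') dvd order G"
        using orbit_stabilizer[OF orbit(2,3)] by (metis dvd_triv_left)
      moreover have "0 < order G" using fin by (simp add: order_gt_0_iff_finite)
      ultimately have "card (orb U' x') \<le> order G" by (rule dvd_imp_le)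
      then have "d (\<theta> (orbit_type U' x')) = \<zero>\<^bsub>T\<^esub>"
        using orbit by (intro less(1)) auto
      then show ?case
        using orbit orbit_type_closed[OF orbit(2,3)] by (simp add: \<theta>_add \<theta>_closed)
    qed
    show ?case
    proof (rule T.derivation_eq_zero[where d = d and n = n and a = "\<theta> ?t" and l = "\<theta> L"])
      show "\<theta> ?t \<otimes>\<^bsub>T\<^esub> \<theta> ?t = [n] \<cdot>\<^bsub>T\<^esub> \<theta> ?t \<oplus>\<^bsub>T\<^esub> \<theta> L"
        using t L(1) by (simp flip: \<theta>_mult \<theta>_pow \<theta>_add add: sq)
      show "d (\<theta> L \<otimes>\<^bsub>T\<^esub> \<theta> ?t) = \<zero>\<^bsub>T\<^esub>"
        using large[OF large_orbits_mult[OF L(2) t]] t L(1) by (simp add: \<theta>_mult)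
    qed ((rule d_closed d_add d_mult T_tf[OF n]; assumption) |
        simp add: \<theta>_closed t L(1) large[OF L(2)])+
  qed
  have d_class: "A \<in> carrier ?S \<and> d (\<theta> A) = \<zero>\<^bsub>T\<^esub>" if A: "A \<in> carrier ?S" for A
  proof -
    obtain U :: "('a, nat) gset" where U: "finite_gset G U" "A = gset_class G U"
      using A by (rule gset_carrierE)
    from U(1) show ?thesis unfolding U(2)
    proof (induction rule: gset_class_induct)
      case zero
      show ?case using d.hom_zero by (simp add: \<theta>_zero)
    next
      case (orbit A x)
      then show ?case
        using d_orbit[OF U(1) orbit(2)]
          orbit_type_closed[OF U(1) orbit(2)]
        by (simp add: \<theta>_add \<theta>_closed)
    qed
  qed
  have "x \<in> carrier T" using x by (simp add: alg)
  then have "d x = \<zero>\<^bsub>T\<^esub>"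
  proof (induction x rule: tensor_induct)
    case (pure r b)
    obtain A A' where A: "A \<in> carrier ?S" "A' \<in> carrier ?S"
      "b = burnside_class A \<ominus>\<^bsub>?B\<^esub> burnside_class A'"
      using pure(2) by (rule burnside_carrierE)
    have "pure \<one>\<^bsub>R\<^esub> b = \<theta> A \<ominus>\<^bsub>T\<^esub> \<theta> A'"
      unfolding A(3) \<theta>_def
      using A(1,2) by (intro abelian_group_hom.hom_minus[OF pure_hom_right]) (auto simp: burnside_class_closed)
    then have "d (pure \<one>\<^bsub>R\<^esub> b) = \<zero>\<^bsub>T\<^esub>"
      using d.hom_minus[of "\<theta> A" "\<theta> A'"] A(1,2) d_class \<theta>_closed by (simp add: T.minus_eq)
    \<comment> \<open>This reduces to the scalar 1: \<open>r\<close> acts as multiplication by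
      \<open>pure r\<close> of the unit of the Burnside ring, and \<open>d\<close> commutes with
      that action.\<close>
    moreover have "pure r b = pure r \<one>\<^bsub>?B\<^esub> \<otimes>\<^bsub>T\<^esub> pure \<one>\<^bsub>R\<^esub> b"
      using pure by (simp add: pure_mult)
    ultimately show ?case
      using d_smult[of r "pure \<one>\<^bsub>R\<^esub> b"] pure by (simp add: pure_closed)
  next
    case (minus x y)
    then show ?case by (simp add: d.hom_minus T.minus_eq)
  qed (rule d.hom_zero)
  then show ?thesis by (simp add: alg)
qed

theorem proposition4p2:
  fixes R :: "('r, 'm) ring_scheme"
    and G :: "('g, 'n) monoid_scheme"
  assumes "cring R"
    and "group G"
    and "finite (carrier G)"
    and no_torsion: "\<And>r. r \<in> carrier R \<Longrightarrow> [order G] \<cdot>\<^bsub>R\<^esub> r = \<zero>\<^bsub>R\<^esub> \<Longrightarrow> r = \<zero>\<^bsub>R\<^esub>"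
  shows "derivations R (burnside_algebra R G) = {zero_derivation (burnside_algebra R G)} \<and>
         trivial_group (HH1 R (burnside_algebra R G))"
proof -
  interpret group G by fact
  let ?B = "burnside_ring G"
  interpret tensor R ?B using \<open>cring R\<close> cring_burnside_ring by (simp add: tensor_def)
  let ?A = "burnside_algebra R G" and ?z = "zero_derivation (burnside_algebra R G)"
  have ops [simp]: "carrier ?A = carrier T" "\<zero>\<^bsub>?A\<^esub> = \<zero>\<^bsub>T\<^esub>" "\<one>\<^bsub>?A\<^esub> = \<one>\<^bsub>T\<^esub>"
    "\<And>x y. x \<oplus>\<^bsub>?A\<^esub> y = x \<oplus>\<^bsub>T\<^esub> y" "\<And>x y. x \<otimes>\<^bsub>?A\<^esub> y = x \<otimes>\<^bsub>T\<^esub> y"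
    "\<And>r x. r \<odot>\<^bsub>?A\<^esub> x = pure r \<one>\<^bsub>?B\<^esub> \<otimes>\<^bsub>T\<^esub> x"
    by (simp_all add: burnside_algebra_def tensor_algebra_def)
  \<comment> \<open>The module record shares its carrier and ring operations with \<open>T\<close>,
    so the ring laws are read off from \<open>T\<close>.\<close>
  have "cring ?A"
  proof (rule cringI)
    show "abelian_group ?A"
      by (rule abelian_groupI) (auto simp: T.a_ac intro: T.l_neg)
    show "comm_monoid ?A"
      by (rule comm_monoidI) (simp_all add: T.m_ac)
  qed (simp add: T.l_distr)
  then interpret A: cring ?A .
  have one: "pure r \<one>\<^bsub>?B\<^esub> \<in> carrier T" if "r \<in> carrier R" for r
    using that by (simp add: pure_closed)
  have "?z \<in> derivations R ?A"
    using one by (auto simp: derivations_def zero_derivation_def)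
  moreover have "d = ?z" if d: "d \<in> derivations R ?A" for d
  proof (rule extensionalityI[where A = "carrier ?A"])
    show "d \<in> extensional (carrier ?A)" using d by (simp add: derivations_def PiE_iff)
    show "?z \<in> extensional (carrier ?A)" by (simp add: zero_derivation_def)
    show "d x = ?z x" if "x \<in> carrier ?A" for x
      using burnside_derivation_eq_zero[OF assms(1,3) no_torsion d that] that
      by (simp add: zero_derivation_def)
  qed
  ultimately have der: "derivations R ?A = {?z}" by blast
  have commutator: "(\<lambda>x\<in>carrier ?A. c \<otimes>\<^bsub>?A\<^esub> x \<ominus>\<^bsub>?A\<^esub> x \<otimes>\<^bsub>?A\<^esub> c) = ?z" if "c \<in> carrier ?A" for c
    unfolding zero_derivation_def using that
    by (intro restrict_ext) (simp add: A.m_comm A.minus_eq A.r_neg del: ops)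
  have const_image: "{f c | c. c \<in> M} = {z}" if "\<And>c. c \<in> M \<Longrightarrow> f c = z" "c0 \<in> M"
    for f :: "'x \<Rightarrow> 'y" and M z c0
    using that by blast
  \<comment> \<open>Commutators vanish in a commutative ring, and taking \<open>c\<close> to be zero
    shows that the set is nonempty.\<close>
  have inner: "inner_derivations ?A = {?z}"
    unfolding inner_derivations_def by (rule const_image[OF commutator A.zero_closed])
  have zz: "?z \<otimes>\<^bsub>derivation_group R ?A\<^esub> ?z = ?z"
    by (auto simp: derivation_group_def zero_derivation_def fun_eq_iff)
  have car: "carrier (derivation_group R ?A) = {?z}"
    by (simp add: derivation_group_def der)
  \<comment> \<open>The derivation group and the subgroup of inner derivations both consist of
    \<open>?z\<close> alone, so the quotient has the single coset \<open>{?z}\<close>.\<close>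
  have HH: "carrier (HH1 R ?A) = {{?z}}" "\<one>\<^bsub>HH1 R ?A\<^esub> = {?z}" "{?z} \<otimes>\<^bsub>HH1 R ?A\<^esub> {?z} = {?z}"
    by (simp_all add: HH1_def FactGroup_def RCOSETS_def r_coset_def set_mult_def inner car zz)
  have "group (HH1 R ?A)"
    by (rule groupI) (simp_all add: HH)
  then show ?thesis using der HH by (simp add: trivial_group_def)
qed

end
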